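(* Let $K,L\subset\mathbb{R}^n$ be convex bodies and $p>1$. Then for all $\lambda\in(0,1)$, \[ \mathcal{W} \bigl((1-\lambda)\cdot K+_p \lambda \cdot L\bigr)^{p/n} \geqslant \frac{1}{(n!)^{p/n}} \left((1-\lambda ) \mathcal{W}(K)^{p/n} + \lambda \mathcal{W}(L)^{p/n}\right). \]
   Context: A convex body is a nonempty compact convex subset of $\mathbb{R}^n$. $\mathcal{W}(K)=\sum_{i=0}^n \mathrm{V}_i(K)$ is the Wills functional, the sum of the intrinsic volumes $\mathrm{V}_i$ of $K$ (equivalently $\mathcal{W}(K)=\int_{\mathbb{R}^n}e^{-\pi d(x,K)^2}\,\mathrm{d}x$, where $d(x,K)$ is the Euclidean distance from $x$ to $K$). For $p>1$ let $q$ be its Hölder conjugate, $1/p+1/q=1$. For nonempty sets $K,L\subset\mathbb{R}^n$ the $p$-sum is $K+_pL=\{(1-\mu)^{1/q}x+\mu^{1/q}y : x\in K,\ y\in L,\ \mu\in[0,1]\}$, and $\lambda\cdot K=\lambda^{1/p}K$ for $\lambda\geqslant0$. *)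

theory Defs
  imports "HOL-Analysis.Analysis"
begin

definition convex_body :: "'a::euclidean_space set \<Rightarrow> bool" where
  "convex_body K \<longleftrightarrow> K \<noteq> {} \<and> compact K \<and> convex K"

text \<open>Wills functional, via the Gaussian-distance integral representation.\<close>
definition wills :: "'a::euclidean_space set \<Rightarrow> real" where
  "wills K = integral UNIV (\<lambda>x. exp (- pi * (infdist x K)\<^sup>2))"

definition hconj :: "real \<Rightarrow> real" where
  "hconj p = p / (p - 1)"

definition psum :: "real \<Rightarrow> 'a::real_vector set \<Rightarrow> 'a set \<Rightarrow> 'a set" where
  "psum p K L = {(1 - \<mu>) powr (1 / hconj p) *\<^sub>R x + \<mu> powr (1 / hconj p) *\<^sub>R y
                   | x y \<mu>. x \<in> K \<and> y \<in> L \<and> \<mu> \<in> {0..1}}"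

definition pscale :: "real \<Rightarrow> real \<Rightarrow> 'a::real_vector set \<Rightarrow> 'a set" where
  "pscale p t K = (\<lambda>x. (t powr (1 / p)) *\<^sub>R x) ` K"

end

theory Submission
  imports Defs "HOL-Probability.Distributions"
begin

text \<open>Compare the Wills functional with the volume \<open>V\<close> of the neighbourhood of radius \<open>r\<close>, where \<open>r\<close>
  depends on the dimension \<open>n\<close> only. By the Brunn--Minkowski inequality, \<open>V\<close> of \<open>a K + b L\<close> satisfies
  the concavity inequality for \<open>n\<close>-th roots as soon as \<open>a + b \<le> 1\<close>. The p-sum contains such
  combinations, and the best of them gives the claim for \<open>V\<close> with constant 1, without any assumption
  on the position of the origin. It remains to find \<open>r\<close> with \<open>wills K \<le> V K \<le> n! * wills K\<close>
  for all convex bodies. The left inequality holds if the ball of radius \<open>r\<close> has volume at least 1: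
  the \<open>n\<close>-th root of the volume of the neighbourhood of radius \<open>s\<close> is concave in \<open>s\<close>, hence below a
  supporting line at \<open>r\<close>, and integrating over the level sets of the Gaussian of the distance compares
  \<open>K\<close> with a single point, whose Wills functional is 1. The right inequality bounds that
  Gaussian from below by a step function; for \<open>n = 1\<close> and \<open>r = 1/2\<close> both inequalities are
  equalities.\<close>

section \<open>The Brunn--Minkowski inequality\<close>

lemma open_set_plus:
  fixes A B :: "'a::real_normed_vector set"
  assumes "open A"
  shows "open (A + B)"
proof -
  have "A + B = (\<Union>x\<in>A. \<Union>y\<in>B. {x + y})"
    by (auto simp: set_plus_def)
  then show ?thesis
    using open_sums[of A B] assms by simp
qed

lemma bounded_set_plus:
  fixes A B :: "'a::real_normed_vector set"
  assumes "bounded A" "bounded B"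
  shows "bounded (A + B)"
proof -
  have "A + B = (\<Union>x\<in>A. \<Union>y\<in>B. {x + y})"
    by (auto simp: set_plus_def)
  then show ?thesis
    using bounded_sums[OF assms] by simp
qed

lemma open_bounded_fmeasurable:
  fixes A :: "'a::euclidean_space set"
  assumes "open A" "bounded A"
  shows "A \<in> fmeasurable lborel"
  using assms emeasure_bounded_finite[of A] by (auto simp: fmeasurable_def)

lemma measure_open_pos:
  fixes A :: "'a::euclidean_space set"
  assumes "open A" "bounded A" "A \<noteq> {}"
  shows "measure lborel A > 0"
proof -
  obtain x e where "e > 0" "ball x e \<subseteq> A"
    using assms openE by blast
  then have "measure lborel (ball x e) \<le> measure lborel A"
    by (intro measure_mono_fmeasurable open_bounded_fmeasurable assms) auto
  moreover have "measure lborel (ball x e) > 0"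
    using \<open>e > 0\<close> by (simp add: content_ball)
  ultimately show ?thesis
    by linarith
qed

section \<open>Brunn--Minkowski for two boxes\<close>

lemma box_plus_box:
  fixes a b c d :: "'a::euclidean_space"
  assumes "box a b \<noteq> {}" "box c d \<noteq> {}"
  shows "box (a + c) (b + d) \<subseteq> box a b + box c d"
proof
  fix z assume z: "z \<in> box (a + c) (b + d)"
  have ab: "a \<bullet> i < b \<bullet> i" "c \<bullet> i < d \<bullet> i" if "i \<in> Basis" for i
    using assms that by (auto simp: box_ne_empty)
  \<comment> \<open>The relative position of \<open>z\<close> in each coordinate interval of the
    sum; \<open>x\<close> takes the same position in \<open>box a b\<close>, which leaves
    \<open>z - x\<close> at that position in \<open>box c d\<close>.\<close>
  define \<theta> where "\<theta> i = (z \<bullet> i - (a + c) \<bullet> i) / ((b + d) \<bullet> i - (a + c) \<bullet> i)" for i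
  define x where "x = (\<Sum>i\<in>Basis. (a \<bullet> i + \<theta> i * (b \<bullet> i - a \<bullet> i)) *\<^sub>R i)"
  have th: "0 < \<theta> i" "\<theta> i < 1" if "i \<in> Basis" for i
    using z ab[OF that] that by (auto simp: \<theta>_def box_def inner_add_left field_simps)
  have x: "x \<bullet> i = a \<bullet> i + \<theta> i * (b \<bullet> i - a \<bullet> i)" if "i \<in> Basis" for i
    unfolding x_def using that by (simp add: inner_sum_left_Basis)
  have "(z - x) \<bullet> i = c \<bullet> i + \<theta> i * (d \<bullet> i - c \<bullet> i)" if "i \<in> Basis" for i
  proof -
    have "z \<bullet> i = (a + c) \<bullet> i + \<theta> i * ((b + d) \<bullet> i - (a + c) \<bullet> i)"
      using ab[OF that] by (simp add: \<theta>_def inner_add_left)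
    then show ?thesis
      by (simp add: inner_diff_left x that inner_add_left algebra_simps)
  qed
  moreover have "p < p + t * (q - p) \<and> p + t * (q - p) < q" if "p < q" "0 < t" "t < 1" for p q t :: real
  proof -
    have "0 < t * (q - p)" "t * (q - p) < 1 * (q - p)"
      using that by (auto intro: mult_strict_right_mono)
    then show ?thesis by simp
  qed
  ultimately have "x \<in> box a b" "z - x \<in> box c d"
    using ab th by (auto simp: box_def x)
  then show "z \<in> box a b + box c d"
    by (metis add.commute diff_add_cancel set_plus_intro)
qed

text \<open>Superadditivity of the geometric mean: after division by the root of \<open>?P\<close>,
  the arithmetic-geometric mean inequality bounds the two summands by the means of
  \<open>u i / (u i + v i)\<close> and of \<open>v i / (u i + v i)\<close>, which add up to
  1.\<close>

lemma root_prod_add_le: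
  fixes u v :: "'i \<Rightarrow> real"
  assumes "finite I" "I \<noteq> {}" and pos: "\<And>i. i \<in> I \<Longrightarrow> u i > 0" "\<And>i. i \<in> I \<Longrightarrow> v i > 0"
  shows "root (card I) (\<Prod>i\<in>I. u i) + root (card I) (\<Prod>i\<in>I. v i)
    \<le> root (card I) (\<Prod>i\<in>I. u i + v i)"
proof -
  let ?n = "card I" and ?P = "\<Prod>i\<in>I. u i + v i"
  have n: "?n > 0"
    using assms by (simp add: card_gt_0_iff)
  have w: "u i + v i > 0" if "i \<in> I" for i
    using pos[OF that] by simp
  have P: "?P > 0"
    using w by (simp add: prod_pos)
  have pp: "(\<Prod>i\<in>I. f i) / ?P > 0" if "\<And>i. i \<in> I \<Longrightarrow> f i > 0" for f
    using divide_pos_pos[OF prod_pos P] that by blast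
  have *: "root ?n (\<Prod>i\<in>I. f i) \<le> root ?n ?P * (\<Sum>i\<in>I. f i / (u i + v i) / ?n)"
    if f: "\<And>i. i \<in> I \<Longrightarrow> f i > 0" for f
  proof -
    have "(\<Prod>i\<in>I. f i / (u i + v i)) powr (1 / ?n) \<le> (\<Sum>i\<in>I. f i / (u i + v i) / ?n)"
      using f w assms by (intro arith_geom_mean) (auto intro: less_imp_le)
    moreover have "(\<Prod>i\<in>I. f i / (u i + v i)) powr (1 / ?n) = root ?n (\<Prod>i\<in>I. f i) / root ?n ?P"
      using n root_powr_inverse[OF n less_imp_le[OF pp[of f]]] f
      by (simp add: prod_dividef flip: real_root_divide)
    ultimately show ?thesis
      using P n by (simp add: field_simps)
  qed
  have "root ?n (\<Prod>i\<in>I. u i) + root ?n (\<Prod>i\<in>I. v i)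
    \<le> root ?n ?P * ((\<Sum>i\<in>I. u i / (u i + v i) / ?n) + (\<Sum>i\<in>I. v i / (u i + v i) / ?n))"
    using *[of u] *[of v] pos by (simp add: distrib_left)
  also have "(\<Sum>i\<in>I. u i / (u i + v i) / ?n) + (\<Sum>i\<in>I. v i / (u i + v i) / ?n) = (\<Sum>i\<in>I. 1 / ?n)"
    unfolding sum.distrib[symmetric]
  proof (rule sum.cong)
    fix i assume "i \<in> I"
    then have "u i / (u i + v i) + v i / (u i + v i) = 1"
      using w[of i] by (simp flip: add_divide_distrib)
    then show "u i / (u i + v i) / ?n + v i / (u i + v i) / ?n = 1 / ?n"
      by (metis add_divide_distrib)
  qed simp
  finally show ?thesis
    using n by simp
qed

lemma Brunn_Minkowski_box:
  fixes a b c d :: "'a::euclidean_space"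
  assumes "box a b \<noteq> {}" "box c d \<noteq> {}"
  shows "root DIM('a) (measure lborel (box a b)) + root DIM('a) (measure lborel (box c d))
    \<le> root DIM('a) (measure lborel (box a b + box c d))"
proof -
  have ab: "a \<bullet> i < b \<bullet> i" "c \<bullet> i < d \<bullet> i" if "i \<in> Basis" for i
    using assms that by (auto simp: box_ne_empty)
  have "root DIM('a) (measure lborel (box a b)) + root DIM('a) (measure lborel (box c d)) \<le>
    root DIM('a) (\<Prod>i\<in>Basis. (b - a) \<bullet> i + (d - c) \<bullet> i)"
    using root_prod_add_le[of "Basis :: 'a set" "\<lambda>i. (b - a) \<bullet> i" "\<lambda>i. (d - c) \<bullet> i"] ab
    by (simp add: inner_diff_left measure_lborel_box_eq less_imp_le)
  also have "(\<Prod>i\<in>Basis. (b - a) \<bullet> i + (d - c) \<bullet> i) = measure lborel (box (a + c) (b + d))"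
    using ab by (subst measure_lborel_box)
      (auto simp: inner_add_left inner_diff_left algebra_simps intro!: prod.cong add_mono add_strict_mono less_imp_le)
  also have "\<dots> \<le> measure lborel (box a b + box c d)"
    by (intro measure_mono_fmeasurable box_plus_box assms open_bounded_fmeasurable open_set_plus
      bounded_set_plus bounded_box open_box) simp
  finally show ?thesis
    by simp
qed

text \<open>Hadwiger--Ohmann: Brunn--Minkowski for finite unions of disjoint open boxes, by induction on
  the number of boxes, cutting both sets by parallel coordinate hyperplanes in equal proportions.\<close>

definition boxes :: "'a::euclidean_space set set \<Rightarrow> bool" where
  "boxes \<D> \<longleftrightarrow> finite \<D> \<and> disjoint \<D> \<and> (\<forall>X\<in>\<D>. X \<noteq> {} \<and> (\<exists>a b. X = box a b))"

lemma open_Union_boxes: "boxes \<D> \<Longrightarrow> open (\<Union>\<D>)"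
  by (auto simp: boxes_def intro!: open_Union)

lemma bounded_Union_boxes: "boxes \<D> \<Longrightarrow> bounded (\<Union>\<D>)"
  by (auto simp: boxes_def intro!: bounded_Union)

text \<open>Empty traces are dropped because \<open>boxes\<close> admits nonempty members only; thus
  a hyperplane with a box entirely on its other side lowers the number of boxes.\<close>

definition trace_on :: "'a set \<Rightarrow> 'a set set \<Rightarrow> 'a set set" where
  "trace_on H \<D> = (\<inter>) H ` \<D> - {{}}"

lemma Union_trace_on: "\<Union>(trace_on H \<D>) = H \<inter> \<Union>\<D>"
  by (auto simp: trace_on_def)

lemma card_trace_on:
  assumes "finite \<D>"
  shows "card (trace_on H \<D>) \<le> card \<D>"
proof -
  have "card (trace_on H \<D>) \<le> card ((\<inter>) H ` \<D>)"
    unfolding trace_on_def using assms by (intro card_mono) auto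
  also have "\<dots> \<le> card \<D>"
    by (rule card_image_le[OF assms])
  finally show ?thesis .
qed

lemma card_trace_on_less:
  assumes "finite \<D>" "X \<in> \<D>" "H \<inter> X = {}"
  shows "card (trace_on H \<D>) < card \<D>"
proof -
  have "trace_on H \<D> \<subseteq> (\<inter>) H ` (\<D> - {X})"
    using assms by (auto simp: trace_on_def)
  then have "card (trace_on H \<D>) \<le> card ((\<inter>) H ` (\<D> - {X}))"
    using assms by (intro card_mono) auto
  also have "\<dots> \<le> card (\<D> - {X})"
    using assms by (intro card_image_le) auto
  also have "\<dots> < card \<D>"
    using assms by (intro psubset_card_mono) auto
  finally show ?thesis .
qed

lemma boxes_trace_on:
  assumes "boxes \<D>" and H: "\<And>a b. \<exists>c d. H \<inter> box a b = box c d"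
  shows "boxes (trace_on H \<D>)"
proof -
  have "disjoint (trace_on H \<D>)"
    using assms(1) unfolding boxes_def trace_on_def disjoint_def by blast
  then show ?thesis
    using assms by (fastforce simp: boxes_def trace_on_def)
qed

lemma lower_halfspace_Int_box:
  fixes i :: "'a::euclidean_space"
  assumes "i \<in> Basis"
  shows "\<exists>p q. {x. x \<bullet> i < s} \<inter> box a b = box p q"
proof (intro exI)
  let ?q = "\<Sum>j\<in>Basis. (if j = i then min s (b \<bullet> i) else b \<bullet> j) *\<^sub>R j"
  have "?q \<bullet> j = (if j = i then min s (b \<bullet> i) else b \<bullet> j)" if "j \<in> Basis" for j
    using that by (subst inner_sum_left_Basis) auto
  then show "{x. x \<bullet> i < s} \<inter> box a b = box a ?q"
    using assms by (auto simp: box_def)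
qed

lemma upper_halfspace_Int_box:
  fixes i :: "'a::euclidean_space"
  assumes "i \<in> Basis"
  shows "\<exists>p q. {x. x \<bullet> i > s} \<inter> box a b = box p q"
proof (intro exI)
  let ?p = "\<Sum>j\<in>Basis. (if j = i then max s (a \<bullet> i) else a \<bullet> j) *\<^sub>R j"
  have "?p \<bullet> j = (if j = i then max s (a \<bullet> i) else a \<bullet> j)" if "j \<in> Basis" for j
    using that by (subst inner_sum_left_Basis) auto
  then show "{x. x \<bullet> i > s} \<inter> box a b = box ?p b"
    using assms by (auto simp: box_def)
qed

lemma measure_hyperplane_split:
  fixes i :: "'a::euclidean_space"
  assumes "i \<in> Basis" "open A" "bounded A"
  shows "measure lborel A
    = measure lborel ({x. x \<bullet> i < s} \<inter> A) + measure lborel ({x. x \<bullet> i > s} \<inter> A)"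
proof -
  have "{x. x \<bullet> i = s} \<in> null_sets lborel"
    using negligible_standard_hyperplane[OF assms(1), of s]
    by (simp add: negligible_iff_null_sets null_sets_completion_iff closed_hyperplane)
  then have N: "{x. x \<bullet> i = s} \<inter> A \<in> null_sets lborel"
    using assms by (intro null_set_Int2) auto
  have op: "open ({x. x \<bullet> i < s} \<inter> A)" "open ({x. x \<bullet> i > s} \<inter> A)"
    using assms open_halfspace_component_lt[of i s] open_halfspace_component_gt[of s i] by auto
  have "A = (({x. x \<bullet> i < s} \<inter> A) \<union> ({x. x \<bullet> i > s} \<inter> A)) \<union> ({x. x \<bullet> i = s} \<inter> A)"
    by auto
  then have "measure lborel A = measure lborel (({x. x \<bullet> i < s} \<inter> A) \<union> ({x. x \<bullet> i > s} \<inter> A))"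
    using measure_Un_null_set[OF _ N] op by (metis (no_types, lifting) borel_open open_Un sets_lborel)
  also have "\<dots> = measure lborel ({x. x \<bullet> i < s} \<inter> A) + measure lborel ({x. x \<bullet> i > s} \<inter> A)"
    by (subst measure_Un2) (auto intro!: open_bounded_fmeasurable op bounded_Int assms
      arg_cong[where f = "measure lborel"])
  finally show ?thesis .
qed

text \<open>Moving the hyperplane from \<open>s\<close> to \<open>t\<close> adds only points of a
  slab of \<open>box a b\<close>, of volume at most \<open>C * (t - s)\<close> with \<open>C\<close>
  the product of the other side lengths. Hence the function is even Lipschitz.\<close>

lemma continuous_measure_lower_halfspace:
  fixes i :: "'a::euclidean_space"
  assumes i: "i \<in> Basis" and A: "open A" "A \<subseteq> box a b"
  shows "continuous_on UNIV (\<lambda>s. measure lborel ({x. x \<bullet> i < s} \<inter> A))"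
proof -
  let ?f = "\<lambda>s. measure lborel ({x. x \<bullet> i < s} \<inter> A)"
  define C where "C = (\<Prod>j\<in>Basis - {i}. \<bar>b \<bullet> j - a \<bullet> j\<bar>)"
  have C: "C \<ge> 0"
    unfolding C_def by (rule prod_nonneg) simp
  have bA: "bounded A"
    using A bounded_box bounded_subset by blast
  have op: "open ({x. x \<bullet> i < s} \<inter> A)" for s
    using A open_halfspace_component_lt[of i s] by auto
  have step: "\<bar>?f t - ?f s\<bar> \<le> C * (t - s)" if st: "s \<le> t" for s t
  proof -
    let ?p = "\<Sum>j\<in>Basis. (if j = i then s else a \<bullet> j) *\<^sub>R j"
    let ?q = "\<Sum>j\<in>Basis. (if j = i then t else b \<bullet> j) *\<^sub>R j"
    have p: "?p \<bullet> j = (if j = i then s else a \<bullet> j)" and q: "?q \<bullet> j = (if j = i then t else b \<bullet> j)"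
      if "j \<in> Basis" for j
      using that by (simp_all only: inner_sum_left_Basis)
    have sub: "({x. x \<bullet> i < t} \<inter> A) - ({x. x \<bullet> i < s} \<inter> A) \<subseteq> cbox ?p ?q"
    proof
      fix x assume "x \<in> ({x. x \<bullet> i < t} \<inter> A) - ({x. x \<bullet> i < s} \<inter> A)"
      then have "x \<in> box a b" "s \<le> x \<bullet> i" "x \<bullet> i < t"
        using A by auto
      then show "x \<in> cbox ?p ?q"
        unfolding mem_box by (auto simp: p q less_imp_le simp del: inner_sum_left_Basis)
    qed
    have "?f t = measure lborel (({x. x \<bullet> i < s} \<inter> A) \<union> ({x. x \<bullet> i < t} \<inter> A))"
      using st by (intro arg_cong[where f = "measure lborel"]) auto
    also have "\<dots> = ?f s + measure lborel (({x. x \<bullet> i < t} \<inter> A) - ({x. x \<bullet> i < s} \<inter> A))"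
      by (intro measure_Un2 open_bounded_fmeasurable op bounded_Int) (use bA in auto)
    finally have "\<bar>?f t - ?f s\<bar> = measure lborel (({x. x \<bullet> i < t} \<inter> A) - ({x. x \<bullet> i < s} \<inter> A))"
      by simp
    also have "\<dots> \<le> measure lborel (cbox ?p ?q)"
      using op by (intro measure_mono_fmeasurable sub) (auto intro!: sets.Diff)
    also have "\<dots> \<le> (\<Prod>j\<in>Basis. \<bar>?q \<bullet> j - ?p \<bullet> j\<bar>)"
      unfolding measure_lborel_cbox_eq
      by (auto simp: inner_diff_left intro!: prod_nonneg prod_mono simp del: inner_sum_left_Basis)
    also have "\<dots> = (\<Prod>j\<in>Basis. if j = i then t - s else \<bar>b \<bullet> j - a \<bullet> j\<bar>)"
      using st by (intro prod.cong refl) (simp only: p q, simp)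
    also have "\<dots> = C * (t - s)"
      using i by (subst prod.remove[of _ i]) (auto simp: C_def)
    finally show ?thesis .
  qed
  have "\<bar>?f t - ?f s\<bar> \<le> C * \<bar>t - s\<bar>" for s t
    using step[of s t] step[of t s] by (cases "s \<le> t") (auto simp: abs_minus_commute)
  then have "C-lipschitz_on UNIV ?f"
    using C by (intro lipschitz_onI) (auto simp: dist_real_def)
  then show ?thesis
    by (rule lipschitz_on_continuous_on)
qed

text \<open>Two disjoint nonempty boxes have disjoint projections to some coordinate axis, and an
  endpoint of one projection gives the hyperplane.\<close>

lemma boxes_separated:
  fixes \<D> :: "'a::euclidean_space set set"
  assumes "boxes \<D>" "card \<D> \<ge> 2"
  obtains X Y i s where "X \<in> \<D>" "Y \<in> \<D>" "i \<in> Basis" "\<And>x. x \<in> X \<Longrightarrow> x \<bullet> i < s" "\<And>y. y \<in> Y \<Longrightarrow> y \<bullet> i > s"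
proof -
  obtain X Y where XY: "X \<in> \<D>" "Y \<in> \<D>" "X \<noteq> Y"
    using assms card_le_Suc0_iff_eq[of \<D>] unfolding boxes_def
    by (metis not_less_eq_eq numeral_2_eq_2)
  obtain a b c d where box: "X = box a b" "Y = box c d"
    using assms(1) XY unfolding boxes_def by metis
  have ne: "box a b \<noteq> {}" "box c d \<noteq> {}"
    using assms(1) XY box unfolding boxes_def by auto
  have "X \<inter> Y = {}"
    using assms(1) XY unfolding boxes_def disjoint_def by blast
  then obtain i where i: "i \<in> Basis" "b \<bullet> i \<le> c \<bullet> i \<or> d \<bullet> i \<le> a \<bullet> i"
    using ne unfolding box disjoint_interval box_ne_empty by (meson not_less)
  show thesis
  proof (cases "b \<bullet> i \<le> c \<bullet> i")
    case True
    show thesis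
      by (rule that[OF XY(1,2) i(1), of "c \<bullet> i"]) (use True i in \<open>force simp: box mem_box\<close>)+
  next
    case False
    with i have "d \<bullet> i \<le> a \<bullet> i" by simp
    show thesis
      by (rule that[OF XY(2,1) i(1), of "a \<bullet> i"]) (use \<open>d \<bullet> i \<le> a \<bullet> i\<close> i in \<open>force simp: box mem_box\<close>)+
  qed
qed

text \<open>The intermediate value theorem between the two sides of a box around \<open>B\<close>.
  It serves to cut a second set in the same proportion as a first one.\<close>

lemma measure_lower_halfspace_eq:
  fixes i :: "'a::euclidean_space"
  assumes "i \<in> Basis" "open B" "bounded B" "0 \<le> v" "v \<le> measure lborel B"
  obtains t where "measure lborel ({x. x \<bullet> i < t} \<inter> B) = v"
proof -
  obtain a where a: "B \<subseteq> box (-a) a"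
    using bounded_subset_box_symmetric[OF assms(3)] by metis
  let ?f = "\<lambda>t. measure lborel ({x. x \<bullet> i < t} \<inter> B)"
  have cont: "continuous_on S ?f" for S
    using continuous_measure_lower_halfspace[OF assms(1,2) a] continuous_on_subset by blast
  have sub: "- a \<bullet> i < x \<bullet> i" "x \<bullet> i < a \<bullet> i" if "x \<in> B" for x
    using a that assms(1) by (auto simp: mem_box)
  have "{x. x \<bullet> i < - a \<bullet> i} \<inter> B = {}" "{x. x \<bullet> i < a \<bullet> i} \<inter> B = B"
    using sub by force+
  then have f: "?f (- a \<bullet> i) = 0" "?f (a \<bullet> i) = measure lborel B"
    by simp_all
  show thesis
  proof (cases "B = {}")
    case True
    then show thesis using assms that by auto
  next
    case False
    then have "- a \<bullet> i \<le> a \<bullet> i"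
      using sub by (metis all_not_in_conv less_imp_le less_trans)
    then show thesis
      using IVT'[of ?f "- a \<bullet> i" v "a \<bullet> i"] f cont assms that by auto
  qed
qed

text \<open>A common factor of the volumes comes out of the n-th power, so that the inequalities for
  the two pieces of a cut, with factors \<theta> and 1 - \<theta>, can be added.\<close>

lemma root_add_power_le_scaled:
  assumes "n > 0" "root n (c * u) + root n (c * v) \<le> root n w" "0 \<le> c" "0 \<le> u" "0 \<le> v" "0 \<le> w"
  shows "c * (root n u + root n v) ^ n \<le> w"
proof -
  have "c * (root n u + root n v) ^ n = (root n (c * u) + root n (c * v)) ^ n"
    using assms by (simp add: real_root_mult flip: distrib_left power_mult_distrib)
      (simp add: power_mult_distrib)
  also have "\<dots> \<le> root n w ^ n"
    using assms by (intro power_mono) auto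
  also have "\<dots> = w"
    using assms by simp
  finally show ?thesis .
qed

lemma Brunn_Minkowski_boxes:
  fixes \<D> \<E> :: "'a::euclidean_space set set"
  assumes "boxes \<D>" "boxes \<E>" "\<D> \<noteq> {}" "\<E> \<noteq> {}"
  shows "root DIM('a) (measure lborel (\<Union>\<D>)) + root DIM('a) (measure lborel (\<Union>\<E>))
    \<le> root DIM('a) (measure lborel (\<Union>\<D> + \<Union>\<E>))"
  using assms
proof (induction "card \<D> + card \<E>" arbitrary: \<D> \<E> rule: less_induct)
  case less
  let ?r = "root DIM('a)" and ?m = "measure (lborel :: 'a measure)"
  have n: "DIM('a) > 0" by simp
  \<comment> \<open>Stated for any two families with the same total number of boxes, so that it also
    applies with the roles of \<open>\<D>\<close> and \<open>\<E>\<close> exchanged.\<close>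
  have step: "?r (?m (\<Union>\<P>)) + ?r (?m (\<Union>\<Q>)) \<le> ?r (?m (\<Union>\<P> + \<Union>\<Q>))"
    if PQ: "boxes \<P>" "boxes \<Q>" "\<P> \<noteq> {}" "\<Q> \<noteq> {}" and card: "card \<P> + card \<Q> = card \<D> + card \<E>"
      and two: "card \<P> \<ge> 2" for \<P> \<Q>
  proof -
    define A B where "A = \<Union>\<P>" and "B = \<Union>\<Q>"
    have op: "open A" "open B" "bounded A" "bounded B" "A \<noteq> {}" "B \<noteq> {}"
      using PQ open_Union_boxes bounded_Union_boxes unfolding A_def B_def by (auto simp: boxes_def)
    have fin: "finite \<P>" "finite \<Q>"
      using PQ by (auto simp: boxes_def)
    obtain X Y i s where XY: "X \<in> \<P>" "Y \<in> \<P>" and i: "i \<in> Basis"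
      and X: "\<And>x. x \<in> X \<Longrightarrow> x \<bullet> i < s" and Y: "\<And>y. y \<in> Y \<Longrightarrow> y \<bullet> i > s"
      using boxes_separated[OF PQ(1) two] by metis
    have ne: "X \<noteq> {}" "Y \<noteq> {}"
      using PQ(1) XY by (auto simp: boxes_def)
    define L U where "L = (\<lambda>s. {x. x \<bullet> i < s})" and "U = (\<lambda>s. {x. x \<bullet> i > s})"
    have opLU: "open (L s)" "open (U s)" for s
      unfolding L_def U_def by (simp_all add: open_halfspace_component_lt open_halfspace_component_gt)
    have bx: "\<exists>p q. L s \<inter> box a b = box p q" "\<exists>p q. U s \<inter> box a b = box p q" for s a b
      unfolding L_def U_def using lower_halfspace_Int_box[OF i] upper_halfspace_Int_box[OF i] by auto
    have bt: "boxes (trace_on (L s) \<P>)" "boxes (trace_on (U s) \<P>)"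
        "boxes (trace_on (L s) \<Q>)" "boxes (trace_on (U s) \<Q>)" for s
      using boxes_trace_on[OF PQ(1)] boxes_trace_on[OF PQ(2)] bx by simp_all
    have split: "?m C = ?m (L s \<inter> C) + ?m (U s \<inter> C)" if "open C" "bounded C" for C s
      unfolding L_def U_def using measure_hyperplane_split[OF i that] .
    have LX: "L s \<inter> Y = {}" "U s \<inter> X = {}"
      using X Y unfolding L_def U_def by force+
    have A0: "?m A > 0" "?m B > 0"
      using op by (auto intro: measure_open_pos)
    have XA: "X \<subseteq> L s \<inter> A" "Y \<subseteq> U s \<inter> A"
      using X Y XY unfolding L_def U_def A_def by auto
    then have neA: "L s \<inter> A \<noteq> {}" "U s \<inter> A \<noteq> {}"
      using ne by auto
    then have A12: "?m (L s \<inter> A) > 0" "?m (U s \<inter> A) > 0"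
      using op opLU by (auto intro!: measure_open_pos bounded_Int)
    define \<theta> where "\<theta> = ?m (L s \<inter> A) / ?m A"
    have mL: "?m (L s \<inter> A) = \<theta> * ?m A" and mU: "?m (U s \<inter> A) = (1 - \<theta>) * ?m A"
      using A0 split[OF op(1,3), of s] by (simp_all add: \<theta>_def field_simps)
    have th: "0 < \<theta>" "\<theta> < 1"
      using A0 A12 mL mU by (simp_all add: zero_less_mult_iff)
    \<comment> \<open>\<open>B\<close> is cut at its own height \<open>t\<close>, in the proportion
      in which \<open>A\<close> is cut at \<open>s\<close>; this replaces a translation of
      \<open>B\<close>.\<close>
    obtain t where t: "?m (L t \<inter> B) = \<theta> * ?m B"
      using measure_lower_halfspace_eq[OF i op(2,4), of "\<theta> * ?m B"] th A0
      unfolding L_def by (auto simp: mult_le_cancel_right1)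
    then have t': "?m (U t \<inter> B) = (1 - \<theta>) * ?m B"
      using split[OF op(2,4), of t] by (simp add: algebra_simps)
    have neB: "L t \<inter> B \<noteq> {}" "U t \<inter> B \<noteq> {}"
      using t t' th A0 by (metis diff_gt_0_iff_gt less_irrefl measure_empty mult_pos_pos)+
    \<comment> \<open>\<open>Y\<close> disappears from the lower trace of \<open>\<P>\<close>, and a
      trace never has more boxes than its family, so the total number drops. For the upper traces it
      is \<open>X\<close> that disappears.\<close>
    have "?r (?m (\<Union>(trace_on (L s) \<P>))) + ?r (?m (\<Union>(trace_on (L t) \<Q>)))
      \<le> ?r (?m (\<Union>(trace_on (L s) \<P>) + \<Union>(trace_on (L t) \<Q>)))"
      by (rule less(1))
        (use card_trace_on_less[OF fin(1) XY(2) LX(1)] card_trace_on[OF fin(2), of "L t"] card PQ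
          bt neA neB Union_trace_on[of "L s" \<P>] Union_trace_on[of "L t" \<Q>]
          in \<open>auto simp: A_def B_def\<close>)
    then have 1: "?r (\<theta> * ?m A) + ?r (\<theta> * ?m B) \<le> ?r (?m (L s \<inter> A + L t \<inter> B))"
      by (simp only: Union_trace_on mL t flip: A_def B_def)
    have "?r (?m (\<Union>(trace_on (U s) \<P>))) + ?r (?m (\<Union>(trace_on (U t) \<Q>)))
      \<le> ?r (?m (\<Union>(trace_on (U s) \<P>) + \<Union>(trace_on (U t) \<Q>)))"
      by (rule less(1))
        (use card_trace_on_less[OF fin(1) XY(1) LX(2)] card_trace_on[OF fin(2), of "U t"] card PQ
          bt neA neB Union_trace_on[of "U s" \<P>] Union_trace_on[of "U t" \<Q>]
          in \<open>auto simp: A_def B_def\<close>)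
    then have 2: "?r ((1 - \<theta>) * ?m A) + ?r ((1 - \<theta>) * ?m B) \<le> ?r (?m (U s \<inter> A + U t \<inter> B))"
      by (simp only: Union_trace_on mU t' flip: A_def B_def)
    let ?R = "(?r (?m A) + ?r (?m B)) ^ DIM('a)"
    have "?R = \<theta> * ?R + (1 - \<theta>) * ?R"
      by (simp add: algebra_simps)
    also have "\<dots> \<le> ?m (L s \<inter> A + L t \<inter> B) + ?m (U s \<inter> A + U t \<inter> B)"
      using th by (intro add_mono root_add_power_le_scaled n 1 2) auto
    \<comment> \<open>Sums of lower parts lie below height \<open>s + t\<close> and sums of upper
      parts above it, so they fill disjoint parts of \<open>A + B\<close>.\<close>
    also have "\<dots> \<le> ?m (L (s + t) \<inter> (A + B)) + ?m (U (s + t) \<inter> (A + B))"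
    proof (intro add_mono measure_mono_fmeasurable)
      show "L s \<inter> A + L t \<inter> B \<subseteq> L (s + t) \<inter> (A + B)" "U s \<inter> A + U t \<inter> B \<subseteq> U (s + t) \<inter> (A + B)"
        by (auto simp: L_def U_def inner_add_left set_plus_def)
      show "L (s + t) \<inter> (A + B) \<in> fmeasurable lborel" "U (s + t) \<inter> (A + B) \<in> fmeasurable lborel"
        using op opLU by (auto intro!: open_bounded_fmeasurable open_set_plus open_Int
            intro: bounded_subset[OF bounded_set_plus[OF op(3,4)]])
      show "L s \<inter> A + L t \<inter> B \<in> sets lborel" "U s \<inter> A + U t \<inter> B \<in> sets lborel"
        using op opLU by (simp_all add: open_set_plus open_Int)
    qed
    also have "\<dots> = ?m (A + B)"
      using split[of "A + B" "s + t"] op by (simp add: open_set_plus bounded_set_plus)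
    finally have "?r ?R \<le> ?r (?m (A + B))"
      by simp
    then show ?thesis
      unfolding A_def B_def by (subst (asm) real_root_power_cancel) auto
  qed
  have "finite \<D>" "finite \<E>"
    using less by (auto simp: boxes_def)
  then have "card \<D> > 0" "card \<E> > 0"
    using less by (auto simp: card_gt_0_iff)
  then consider "card \<D> \<ge> 2" | "card \<E> \<ge> 2" | "card \<D> = 1" "card \<E> = 1"
    by linarith
  then show ?case
  proof cases
    case 1
    then show ?thesis using step less by blast
  next
    case 2
    then show ?thesis
      using step[of \<E> \<D>] less by (simp add: add.commute)
  next
    case 3
    then obtain X Y where XY: "\<D> = {X}" "\<E> = {Y}"
      by (metis card_1_singletonE)
    then obtain a b c d where "X = box a b" "Y = box c d" "X \<noteq> {}" "Y \<noteq> {}"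
      using less unfolding boxes_def by auto
    then show ?thesis
      using Brunn_Minkowski_box XY by simp
  qed
qed

section \<open>From finite unions of boxes to open sets\<close>

text \<open>An open set is a countable union of closed boxes, and finitely many of them already have
  nearly the full volume. Their union is divided into non-overlapping closed boxes, whose interiors
  have the same volumes.\<close>

lemma boxes_inner_approximation:
  fixes A :: "'a::euclidean_space set"
  assumes "open A" "bounded A" "e > 0"
  obtains \<D> where "boxes \<D>" "\<Union>\<D> \<subseteq> A" "measure lborel (\<Union>\<D>) > measure lborel A - e"
proof -
  obtain \<C> where \<C>: "countable \<C>" "\<C> \<subseteq> Pow A" "\<And>X. X \<in> \<C> \<Longrightarrow> \<exists>a b. X = cbox a b" "\<Union>\<C> = A"
    using open_countable_Union_open_cbox[OF assms(1)] by metis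
  show thesis
  proof (cases "A = {}")
    case True
    show thesis
      by (rule that[of "{}"]) (use True assms in \<open>auto simp: boxes_def\<close>)
  next
    case False
    then have "\<C> \<noteq> {}"
      using \<C> by auto
    define F where "F k = (\<Union>i<k. from_nat_into \<C> i)" for k :: nat
    have inC: "from_nat_into \<C> i \<in> \<C>" for i
      using \<open>\<C> \<noteq> {}\<close> by (rule from_nat_into)
    have FA: "(\<Union>k. F k) = A"
    proof -
      have "(\<Union>k. F k) = (\<Union>i. from_nat_into \<C> i)"
        unfolding F_def by auto
      then show ?thesis
        using range_from_nat_into[OF \<open>\<C> \<noteq> {}\<close> \<C>(1)] \<C>(4) by simp
    qed
    have closed: "closed (F k)" for k
      unfolding F_def using inC \<C>(3) by (intro closed_UN) (auto, metis closed_cbox)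
    have "(\<lambda>k. measure lborel (F k)) \<longlonglongrightarrow> measure lborel (\<Union>k. F k)"
    proof (rule Lim_measure_incseq)
      show "incseq F"
        unfolding F_def incseq_def by (intro allI impI UN_mono) auto
      show "emeasure lborel (\<Union>k. F k) \<noteq> \<infinity>"
        using emeasure_bounded_finite[OF assms(2)] by (simp add: FA)
    qed (use closed in auto)
    then have "eventually (\<lambda>k. measure lborel (F k) > measure lborel A - e) sequentially"
      using assms(3) by (intro order_tendstoD) (auto simp: FA)
    then obtain k where k: "measure lborel (F k) > measure lborel A - e"
      by (meson eventually_happens sequentially_bot)
    obtain \<P> where "\<P> division_of \<Union>(from_nat_into \<C> ` {..<k})"
      by (rule elementary_unions_intervals[of "from_nat_into \<C> ` {..<k}"]) (use inC \<C>(3) in auto)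
    then have \<P>: "\<P> division_of F k"
      by (simp add: F_def)
    \<comment> \<open>Members of a division may be degenerate; their interiors are empty and are
      removed.\<close>
    define \<D> where "\<D> = interior ` \<P> - {{}}"
    have "boxes \<D>"
      unfolding boxes_def
    proof (intro conjI ballI)
      show "finite \<D>"
        using \<P> by (auto simp: \<D>_def)
      show "disjoint \<D>"
        using division_ofD(5)[OF \<P>] unfolding \<D>_def disjoint_def by blast
      show "X \<noteq> {}" "\<exists>a b. X = box a b" if "X \<in> \<D>" for X
        using that division_ofD(4)[OF \<P>] unfolding \<D>_def by (auto, metis interior_cbox)
    qed
    moreover have "\<Union>\<D> \<subseteq> A"
    proof -
      have "\<Union>\<D> \<subseteq> F k"
        using division_ofD(2)[OF \<P>] interior_subset unfolding \<D>_def by fastforce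
      then show ?thesis
        using FA by blast
    qed
    moreover have "measure lborel (F k) \<le> measure lborel (\<Union>\<D>)"
    proof -
      have box: "\<exists>a b. X = cbox a b" if "X \<in> \<P>" for X
        using division_ofD(4)[OF \<P> that] .
      have "measure lborel (F k) = measure lborel (\<Union>X\<in>\<P>. X)"
        using division_ofD(6)[OF \<P>] by simp
      also have "\<dots> \<le> (\<Sum>X\<in>\<P>. measure lborel X)"
        using \<P> box by (intro measure_UNION_le) auto
      also have "\<dots> = (\<Sum>X\<in>\<P>. measure lborel (interior X))"
        using box by (intro sum.cong refl)
          (metis interior_cbox measure_lborel_box_eq measure_lborel_cbox_eq)
      also have "\<dots> = measure lborel (\<Union>X\<in>\<P>. interior X)"
      proof (rule measure_UNION'[symmetric])
        show "finite \<P>"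
          using \<P> by auto
        show "interior X \<in> fmeasurable lborel" if "X \<in> \<P>" for X
          using box[OF that] by (auto intro!: open_bounded_fmeasurable bounded_interior)
        show "pairwise (\<lambda>X Y. disjnt (interior X) (interior Y)) \<P>"
          using division_ofD(5)[OF \<P>] unfolding pairwise_def disjnt_def by blast
      qed
      also have "(\<Union>X\<in>\<P>. interior X) = \<Union>\<D>"
        unfolding \<D>_def by auto
      finally show ?thesis .
    qed
    ultimately show thesis
      using that k by force
  qed
qed

text \<open>Both sets are approximated from inside by boxes up to volume \<open>e\<close>; the root
  is continuous, so \<open>e\<close> may tend to 0.\<close>

theorem Brunn_Minkowski:
  fixes A B :: "'a::euclidean_space set"
  assumes "open A" "bounded A" "A \<noteq> {}" "open B" "bounded B" "B \<noteq> {}"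
  shows "root DIM('a) (measure lborel A) + root DIM('a) (measure lborel B)
    \<le> root DIM('a) (measure lborel (A + B))"
proof -
  let ?m = "measure (lborel :: 'a measure)" and ?r = "root DIM('a)"
  have pos: "?m A > 0" "?m B > 0"
    using assms by (auto intro: measure_open_pos)
  have le: "?r (?m A - e) + ?r (?m B - e) \<le> ?r (?m (A + B))"
    if e: "0 < e" "e < min (?m A) (?m B)" for e
  proof -
    obtain \<D> where \<D>: "boxes \<D>" "\<Union>\<D> \<subseteq> A" "?m (\<Union>\<D>) > ?m A - e"
      using boxes_inner_approximation assms e by metis
    obtain \<E> where \<E>: "boxes \<E>" "\<Union>\<E> \<subseteq> B" "?m (\<Union>\<E>) > ?m B - e"
      using boxes_inner_approximation assms e by metis
    have "\<D> \<noteq> {}" "\<E> \<noteq> {}"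
      using \<D>(3) \<E>(3) e by auto
    have "?r (?m A - e) + ?r (?m B - e) \<le> ?r (?m (\<Union>\<D>)) + ?r (?m (\<Union>\<E>))"
      using \<D> \<E> by (intro add_mono real_root_le_mono) auto
    also have "\<dots> \<le> ?r (?m (\<Union>\<D> + \<Union>\<E>))"
      by (intro Brunn_Minkowski_boxes) fact+
    also have "\<dots> \<le> ?r (?m (A + B))"
      using assms \<D> \<E>
      by (intro real_root_le_mono measure_mono_fmeasurable open_bounded_fmeasurable open_set_plus
          bounded_set_plus set_plus_mono2) (simp_all add: open_set_plus open_Union_boxes)
    finally show ?thesis .
  qed
  have "((\<lambda>e. ?r (?m A - e) + ?r (?m B - e)) \<longlongrightarrow> ?r (?m A - 0) + ?r (?m B - 0)) (at_right 0)"
    by (intro tendsto_intros)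
  moreover have "eventually (\<lambda>e. ?r (?m A - e) + ?r (?m B - e) \<le> ?r (?m (A + B))) (at_right 0)"
    using le pos unfolding eventually_at_right_field by (metis min_less_iff_conj)
  ultimately show ?thesis
    using tendsto_upperbound by fastforce
qed

section \<open>Volumes of neighbourhoods\<close>

text \<open>The strict inequality makes the neighbourhood open, as \<open>Brunn_Minkowski\<close>
  requires, and makes it exactly a superlevel set of the Gaussian of the distance. It is empty for
  \<open>s \<le> 0\<close>.\<close>

definition nbhd :: "real \<Rightarrow> 'a::euclidean_space set \<Rightarrow> 'a set" where
  "nbhd s K = {x. infdist x K < s}"

lemma mem_nbhd_iff:
  assumes "K \<noteq> {}"
  shows "x \<in> nbhd s K \<longleftrightarrow> (\<exists>k\<in>K. dist x k < s)"
  using assms by (simp add: nbhd_def infdist_notempty cINF_less_iff)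

lemma open_nbhd: "open (nbhd s K)"
  unfolding nbhd_def by (intro open_Collect_less continuous_intros)

lemma bounded_nbhd:
  assumes "K \<noteq> {}" "bounded K"
  shows "bounded (nbhd s K)"
proof -
  obtain R where R: "\<And>k. k \<in> K \<Longrightarrow> norm k \<le> R"
    using assms(2) by (auto simp: bounded_iff)
  show ?thesis
    unfolding bounded_iff
  proof (intro exI ballI)
    fix x assume "x \<in> nbhd s K"
    then obtain k where "k \<in> K" "dist x k < s"
      using mem_nbhd_iff[OF assms(1)] by blast
    then show "norm x \<le> R + s"
      using R[of k] norm_triangle_sub[of x k] by (simp add: dist_norm)
  qed
qed

lemma nbhd_fmeasurable: "K \<noteq> {} \<Longrightarrow> bounded K \<Longrightarrow> nbhd s K \<in> fmeasurable lborel"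
  by (intro open_bounded_fmeasurable open_nbhd bounded_nbhd)

lemma nbhd_mono: "s \<le> t \<Longrightarrow> nbhd s K \<subseteq> nbhd t K"
  by (auto simp: nbhd_def)

lemma measure_nbhd_mono:
  assumes "K \<noteq> {}" "bounded K" "s \<le> t"
  shows "measure lborel (nbhd s K) \<le> measure lborel (nbhd t K)"
  by (intro measure_mono_fmeasurable nbhd_mono nbhd_fmeasurable assms) (simp add: open_nbhd)

lemma nbhd_nonempty: "K \<noteq> {} \<Longrightarrow> s > 0 \<Longrightarrow> nbhd s K \<noteq> {}"
  using mem_nbhd_iff[of K] by (metis dist_self empty_iff equals0I)

lemma measure_nbhd_pos:
  "K \<noteq> {} \<Longrightarrow> bounded K \<Longrightarrow> s > 0 \<Longrightarrow> measure lborel (nbhd s K) > 0"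
  by (intro measure_open_pos open_nbhd bounded_nbhd nbhd_nonempty)

lemma nbhd_scale_add:
  assumes "K \<noteq> {}" "L \<noteq> {}" "a > 0" "b > 0"
  shows "(*\<^sub>R) a ` nbhd s K + (*\<^sub>R) b ` nbhd u L
    \<subseteq> nbhd (a * s + b * u) ((*\<^sub>R) a ` K + (*\<^sub>R) b ` L)"
proof
  fix z assume "z \<in> (*\<^sub>R) a ` nbhd s K + (*\<^sub>R) b ` nbhd u L"
  then obtain x y where z: "z = a *\<^sub>R x + b *\<^sub>R y" "x \<in> nbhd s K" "y \<in> nbhd u L"
    by (auto simp: set_plus_def)
  then obtain k l where kl: "k \<in> K" "dist x k < s" "l \<in> L" "dist y l < u"
    using mem_nbhd_iff assms(1,2) by metis
  have "dist z (a *\<^sub>R k + b *\<^sub>R l) \<le> dist (a *\<^sub>R x) (a *\<^sub>R k) + dist (b *\<^sub>R y) (b *\<^sub>R l)"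
    unfolding z(1) by (rule dist_triangle_add)
  also have "\<dots> = a * dist x k + b * dist y l"
    using assms by (simp add: dist_norm flip: scaleR_diff_right)
  also have "\<dots> < a * s + b * u"
    using assms kl by (intro add_strict_mono mult_strict_left_mono)
  finally have "\<exists>w\<in>(*\<^sub>R) a ` K + (*\<^sub>R) b ` L. dist z w < a * s + b * u"
    using kl by (auto simp: set_plus_def)
  then show "z \<in> nbhd (a * s + b * u) ((*\<^sub>R) a ` K + (*\<^sub>R) b ` L)"
    by (subst mem_nbhd_iff) (use assms in \<open>auto simp: set_plus_def\<close>)
qed

lemma measure_lborel_affine_image:
  fixes A :: "'a::euclidean_space set"
  assumes "open A" "c > 0"
  shows "measure lborel ((\<lambda>x. c *\<^sub>R x + d) ` A) = c ^ DIM('a) * measure lborel A"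
proof -
  have "open ((\<lambda>x. d + c *\<^sub>R x) ` A)"
    using assms open_affinity by force
  then show ?thesis
    using measure_lebesgue_affine[of c d A] assms
    by (simp add: add.commute[of _ d] measure_completion)
qed

text \<open>Brunn--Minkowski for two dilates, the root of the volume being homogeneous of degree 1.
  The coefficients need not add up to 1, since those coming from a p-sum do not.\<close>

theorem root_measure_nbhd_concave:
  fixes K L :: "'a::euclidean_space set"
  assumes "K \<noteq> {}" "bounded K" "L \<noteq> {}" "bounded L" "a > 0" "b > 0" "s > 0" "u > 0"
  shows "a * root DIM('a) (measure lborel (nbhd s K)) + b * root DIM('a) (measure lborel (nbhd u L))
    \<le> root DIM('a) (measure lborel (nbhd (a * s + b * u) ((*\<^sub>R) a ` K + (*\<^sub>R) b ` L)))"
proof -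
  let ?A = "(*\<^sub>R) a ` nbhd s K" and ?B = "(*\<^sub>R) b ` nbhd u L"
  have op: "open ?A" "open ?B"
    using assms by (auto intro!: open_scaling open_nbhd)
  have bd: "bounded ?A" "bounded ?B" "bounded ((*\<^sub>R) a ` K + (*\<^sub>R) b ` L)"
    using assms by (auto intro!: bounded_scaling bounded_nbhd bounded_set_plus)
  have ne: "?A \<noteq> {}" "?B \<noteq> {}" "(*\<^sub>R) a ` K + (*\<^sub>R) b ` L \<noteq> {}"
    using assms nbhd_nonempty[of K s] nbhd_nonempty[of L u] by (auto simp: set_plus_def ex_in_conv[symmetric])
  have *: "root DIM('a) (measure lborel ((*\<^sub>R) c ` A)) = c * root DIM('a) (measure lborel A)"
    if "open A" "c > 0" for c and A :: "'a set"
    using measure_lborel_affine_image[OF that, of 0] that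
    by (simp add: real_root_mult real_root_power_cancel)
  have "root DIM('a) (measure lborel ?A) + root DIM('a) (measure lborel ?B)
    \<le> root DIM('a) (measure lborel (?A + ?B))"
    by (intro Brunn_Minkowski op bd ne)
  also have "\<dots> \<le> root DIM('a) (measure lborel (nbhd (a * s + b * u) ((*\<^sub>R) a ` K + (*\<^sub>R) b ` L)))"
    using assms op bd ne
    by (intro real_root_le_mono measure_mono_fmeasurable nbhd_scale_add nbhd_fmeasurable)
      (simp_all add: open_set_plus)
  finally show ?thesis
    using assms by (simp add: * open_nbhd)
qed

lemma convex_scale_add_self:
  fixes K :: "'a::real_vector set"
  assumes "convex K" "a \<ge> 0" "b \<ge> 0" "a + b = 1"
  shows "(*\<^sub>R) a ` K + (*\<^sub>R) b ` K \<subseteq> K"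
  using assms by (auto simp: set_plus_def convex_def)

text \<open>The previous theorem with both bodies equal to \<open>K\<close> and coefficients of sum
  1: by convexity the combination of \<open>K\<close> with itself stays in \<open>K\<close>.\<close>

lemma concave_on_root_measure_nbhd:
  fixes K :: "'a::euclidean_space set"
  assumes "K \<noteq> {}" "bounded K" "convex K"
  shows "concave_on {0<..} (\<lambda>s. root DIM('a) (measure lborel (nbhd s K)))"
proof (rule concave_on_linorderI)
  fix t s u :: real
  assume t: "0 < t" "t < 1" and su: "s \<in> {0<..}" "u \<in> {0<..}" "s < u"
  let ?M = "(*\<^sub>R) (1 - t) ` K + (*\<^sub>R) t ` K"
  have "?M \<subseteq> K" "?M \<noteq> {}"
    using convex_scale_add_self[OF assms(3), of "1 - t" t] t assms(1) by (auto simp: set_plus_def)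
  then have "nbhd v ?M \<subseteq> nbhd v K" for v
    unfolding nbhd_def using infdist_mono[of ?M K] order_le_less_trans by blast
  then have "root DIM('a) (measure lborel (nbhd v ?M)) \<le> root DIM('a) (measure lborel (nbhd v K))" for v
    using assms by (intro real_root_le_mono measure_mono_fmeasurable nbhd_fmeasurable)
      (simp_all add: open_nbhd)
  from order_trans[OF root_measure_nbhd_concave[OF assms(1,2) assms(1,2)] this]
  show "(1 - t) * root DIM('a) (measure lborel (nbhd s K)) + t * root DIM('a) (measure lborel (nbhd u K))
      \<le> root DIM('a) (measure lborel (nbhd ((1 - t) *\<^sub>R s + t *\<^sub>R u) K))"
    using t su by simp
qed simp

text \<open>The contraction by \<open>c\<close> towards a point of \<open>K\<close> maps
  \<open>K\<close> into itself and shrinks distances to \<open>K\<close> by the factor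
  \<open>c\<close>.\<close>

lemma measure_nbhd_ge_scaled:
  fixes K :: "'a::euclidean_space set"
  assumes "K \<noteq> {}" "bounded K" "convex K" "0 < c" "c \<le> 1"
  shows "c ^ DIM('a) * measure lborel (nbhd r K) \<le> measure lborel (nbhd (c * r) K)"
proof -
  obtain p where p: "p \<in> K"
    using assms by auto
  have "(\<lambda>x. c *\<^sub>R x + (1 - c) *\<^sub>R p) ` nbhd r K \<subseteq> nbhd (c * r) K"
  proof clarify
    fix x assume "x \<in> nbhd r K"
    then obtain k where k: "k \<in> K" "dist x k < r"
      using mem_nbhd_iff assms by metis
    have "c *\<^sub>R k + (1 - c) *\<^sub>R p \<in> K"
      using assms k p by (intro convexD) auto
    moreover have "dist (c *\<^sub>R x + (1 - c) *\<^sub>R p) (c *\<^sub>R k + (1 - c) *\<^sub>R p) < c * r"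
      using assms k by (simp add: dist_norm flip: scaleR_diff_right)
    ultimately show "c *\<^sub>R x + (1 - c) *\<^sub>R p \<in> nbhd (c * r) K"
      using mem_nbhd_iff assms(1) by metis
  qed
  moreover have "open ((\<lambda>x. c *\<^sub>R x + (1 - c) *\<^sub>R p) ` nbhd r K)"
    using open_affinity[OF open_nbhd, of c "(1 - c) *\<^sub>R p" r K] assms by (simp add: add.commute)
  ultimately have "measure lborel ((\<lambda>x. c *\<^sub>R x + (1 - c) *\<^sub>R p) ` nbhd r K) \<le> measure lborel (nbhd (c * r) K)"
    using assms by (intro measure_mono_fmeasurable nbhd_fmeasurable) auto
  then show ?thesis
    using assms by (simp add: measure_lborel_affine_image open_nbhd)
qed

text \<open>The root lies below a supporting line at r; convexity of the n-th power then reduces the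
  profile to its two extreme cases, a constant and the profile of a point.\<close>

lemma measure_nbhd_le_mixture:
  fixes K :: "'a::euclidean_space set"
  assumes "K \<noteq> {}" "bounded K" "convex K" "r > 0"
  obtains \<theta> where "0 \<le> \<theta>" "\<theta> \<le> 1"
    "\<And>s. s > 0 \<Longrightarrow> measure lborel (nbhd s K)
      \<le> measure lborel (nbhd r K) * (\<theta> + (1 - \<theta>) * (s / r) ^ DIM('a))"
proof -
  let ?n = "DIM('a)"
  define g where "g s = root ?n (measure lborel (nbhd s K))" for s
  have g0: "g s \<ge> 0" for s
    by (simp add: g_def)
  have gn: "g s ^ ?n = measure lborel (nbhd s K)" for s
    by (simp add: g_def)
  have gr: "g r > 0"
    using measure_nbhd_pos[OF assms(1,2,4)] by (simp add: g_def)
  have mono: "g s \<le> g t" if "s \<le> t" for s t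
    unfolding g_def using measure_nbhd_mono[OF assms(1,2) that] by simp
  have "convex_on {0<..} (\<lambda>s. - g s)"
    using concave_on_root_measure_nbhd[OF assms(1-3)] by (simp add: concave_on_def g_def)
  \<comment> \<open>The slope comes from a subgradient of the convex function \<open>- g\<close> at
    \<open>r\<close>.\<close>
  then obtain m where m: "g s \<le> g r + m * (s - r)" if "s > 0" for s
    using convex_le_Inf_differential[of "{0<..}" "\<lambda>s. - g s" r] assms(4)
    by (metis (no_types, lifting) greaterThan_iff interior_open neg_le_iff_le open_greaterThan
      minus_add_distrib minus_minus mult_minus_left)
  have "0 \<le> m * r"
    using m[of "2 * r"] mono[of r "2 * r"] assms(4) by simp
  then have m0: "m \<ge> 0"
    using assms(4) by (simp add: zero_le_mult_iff)
  \<comment> \<open>The supporting line is nonnegative at 0, as a limit of its values at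
    \<open>s > 0\<close>, which bound \<open>g s \<ge> 0\<close>. The denominator
    \<open>m + 1\<close> also covers \<open>m = 0\<close>.\<close>
  have "m * r \<le> g r"
  proof (rule field_le_epsilon)
    fix e :: real assume "e > 0"
    define s where "s = e / (m + 1)"
    have "s > 0" "m * s \<le> e"
      using \<open>e > 0\<close> m0 by (auto simp: s_def field_simps)
    then show "m * r \<le> g r + e"
      using m[of s] g0[of s] by (simp add: algebra_simps)
  qed
  \<comment> \<open>The share of the constant term in the value of the supporting line at
    \<open>r\<close>.\<close>
  define \<theta> where "\<theta> = 1 - m * r / g r"
  have th: "0 \<le> \<theta>" "\<theta> \<le> 1"
    using \<open>m * r \<le> g r\<close> \<open>0 \<le> m * r\<close> gr by (auto simp: \<theta>_def)
  have "measure lborel (nbhd s K)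
      \<le> measure lborel (nbhd r K) * (\<theta> + (1 - \<theta>) * (s / r) ^ ?n)" if s: "s > 0" for s
  proof -
    have "g s \<le> g r * (\<theta> + (1 - \<theta>) * (s / r))"
    proof -
      have "g r * (\<theta> + (1 - \<theta>) * (s / r)) = g r + m * (s - r)"
        using gr assms(4) by (simp add: \<theta>_def field_simps)
      then show ?thesis
        using m[OF s] by simp
    qed
    then have "g s ^ ?n \<le> (g r * (\<theta> + (1 - \<theta>) * (s / r))) ^ ?n"
      using g0 by (intro power_mono)
    also have "\<dots> = g r ^ ?n * (\<theta> * 1 + (1 - \<theta>) * (s / r)) ^ ?n"
      by (simp add: power_mult_distrib)
    finally have 1: "g s ^ ?n \<le> g r ^ ?n * (\<theta> * 1 + (1 - \<theta>) * (s / r)) ^ ?n" .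
    have 2: "(\<theta> * 1 + (1 - \<theta>) * (s / r)) ^ ?n \<le> \<theta> * 1 ^ ?n + (1 - \<theta>) * (s / r) ^ ?n"
    proof -
      have "convex_on {0::real..} (\<lambda>x. x ^ ?n)"
        using convex_power_odd convex_power_even convex_on_subset[of UNIV] by (cases "even ?n") auto
      then show ?thesis
        using convex_onD[of "{0..}" "\<lambda>x. x ^ ?n" "1 - \<theta>" 1 "s / r"] th s assms(4) by simp
    qed
    show ?thesis
      using order_trans[OF 1 mult_left_mono[OF 2]] by (simp add: gn)
  qed
  then show thesis
    using that th by blast
qed

section \<open>The Wills functional as an integral over level sets\<close>

text \<open>Fubini for the region below the graph; as \<open>f \<le> 1\<close>, only levels between
  0 and 1 occur.\<close>

lemma layer_cake:
  fixes f :: "'a::euclidean_space \<Rightarrow> real"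
  assumes [measurable]: "f \<in> borel_measurable borel" and f: "\<And>x. 0 \<le> f x" "\<And>x. f x \<le> 1"
  shows "(\<integral>\<^sup>+x. f x \<partial>lborel)
    = (\<integral>\<^sup>+u. indicator {0<..<1} u * emeasure lborel {x. u < f x} \<partial>lborel)"
proof -
  let ?I = "\<lambda>x u. indicator {0<..<1} u * indicator {y. u < f y} x :: ennreal"
  have "(\<integral>\<^sup>+u. indicator {0<..<1} u * emeasure lborel {x. u < f x} \<partial>lborel)
    = (\<integral>\<^sup>+u. \<integral>\<^sup>+x. ?I x u \<partial>lborel \<partial>lborel)"
    by (subst nn_integral_cmult) auto
  also have "\<dots> = (\<integral>\<^sup>+x. \<integral>\<^sup>+u. ?I x u \<partial>lborel \<partial>lborel)"
  proof (rule lborel_pair.Fubini')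
    have "{p \<in> space (lborel \<Otimes>\<^sub>M lborel). snd p < f (fst p)} \<in> sets (lborel \<Otimes>\<^sub>M lborel)"
      by measurable
    then have "{p :: 'a \<times> real. snd p < f (fst p)} \<in> sets (lborel \<Otimes>\<^sub>M lborel)"
      by (simp add: space_pair_measure)
    then have [measurable]: "(\<lambda>p. indicator {p. snd p < f (fst p)} p :: ennreal) \<in> borel_measurable (lborel \<Otimes>\<^sub>M lborel)"
      by (rule borel_measurable_indicator)
    have "case_prod ?I = (\<lambda>p. indicator {0<..<1} (snd p) * indicator {p. snd p < f (fst p)} p)"
      by (auto simp: fun_eq_iff split: split_indicator)
    then show "case_prod ?I \<in> borel_measurable (lborel \<Otimes>\<^sub>M lborel)"
      by simp
  qed
  also have "\<dots> = (\<integral>\<^sup>+x. \<integral>\<^sup>+u. indicator {0<..<f x} u \<partial>lborel \<partial>lborel)"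
    using f by (intro nn_integral_cong) (auto split: split_indicator intro: less_le_trans)
  also have "\<dots> = (\<integral>\<^sup>+x. f x \<partial>lborel)"
    using f by simp
  finally show ?thesis ..
qed

section \<open>Gaussian integrals and the Wills functional\<close>

lemma nn_integral_gaussian_real:
  assumes "c > 0"
  shows "(\<integral>\<^sup>+x. exp (- c * x\<^sup>2) \<partial>lborel) = sqrt (pi / c)"
proof -
  \<comment> \<open>The standard deviation: the integrand is a multiple of the normal density of
    variance \<open>1 / (2 * c)\<close>.\<close>
  let ?s = "1 / sqrt (2 * c)"
  have s: "?s > 0" "2 * ?s\<^sup>2 = 1 / c"
    using assms by (simp_all add: power_divide)
  have *: "exp (- c * x\<^sup>2) = sqrt (pi / c) * normal_density 0 ?s x" for x
  proof -
    have "sqrt (2 * pi * ?s\<^sup>2) = sqrt (pi / c)" "- (x - 0)\<^sup>2 / (2 * ?s\<^sup>2) = - c * x\<^sup>2"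
      using s(2) assms by (simp_all add: power_divide)
    then show ?thesis
      using assms unfolding normal_density_def by simp
  qed
  have "(\<integral>\<^sup>+x. exp (- c * x\<^sup>2) \<partial>lborel) = (\<integral>\<^sup>+x. sqrt (pi / c) * normal_density 0 ?s x \<partial>lborel)"
    unfolding * ..
  also have "\<dots> = ennreal (\<integral>x. sqrt (pi / c) * normal_density 0 ?s x \<partial>lborel)"
    using assms s by (intro nn_integral_eq_integral integrable_mult_right integrable_normal_density) auto
  also have "(\<integral>x. sqrt (pi / c) * normal_density 0 ?s x \<partial>lborel) = sqrt (pi / c)"
    using s by simp
  finally show ?thesis .
qed

lemma nn_integral_gaussian:
  assumes "c > 0"
  shows "(\<integral>\<^sup>+x. exp (- c * (norm x)\<^sup>2) \<partial>(lborel :: 'a::euclidean_space measure)) = sqrt (pi / c) ^ DIM('a)"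
proof -
  have "exp (- c * (norm x)\<^sup>2) = (\<Prod>b\<in>Basis. exp (- c * (x \<bullet> b)\<^sup>2))" for x :: 'a
    unfolding power2_norm_eq_inner euclidean_inner[of x x]
    by (simp add: power2_eq_square sum_distrib_left exp_sum flip: sum_negf)
  then have "(\<integral>\<^sup>+x. exp (- c * (norm x)\<^sup>2) \<partial>(lborel :: 'a measure))
    = (\<integral>\<^sup>+x. (\<Prod>b\<in>Basis. ennreal (exp (- c * (x \<bullet> b)\<^sup>2))) \<partial>(lborel :: 'a measure))"
    by (simp add: prod_ennreal)
  also have "\<dots> = (\<Prod>b\<in>(Basis::'a set). ennreal (sqrt (pi / c)))"
    using nn_integral_gaussian_real[OF assms]
    by (subst nn_integral_lborel_prod[of "\<lambda>b x. ennreal (exp (- c * x\<^sup>2))"]) auto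
  also have "\<dots> = sqrt (pi / c) ^ DIM('a)"
    using assms by (simp add: ennreal_power)
  finally show ?thesis .
qed

text \<open>Links the gauge integral in the definition of \<open>wills\<close> with the Lebesgue
  integral, for which finiteness is required; it follows from domination by a centred
  Gaussian.\<close>

lemma nn_integral_wills:
  fixes K :: "'a::euclidean_space set"
  assumes "K \<noteq> {}" "bounded K"
  shows "(\<integral>\<^sup>+x. exp (- pi * (infdist x K)\<^sup>2) \<partial>lborel) = wills K"
    and "(\<lambda>x. exp (- pi * (infdist x K)\<^sup>2)) integrable_on UNIV"
proof -
  let ?f = "\<lambda>x. exp (- pi * (infdist x K)\<^sup>2)"
  have cont: "continuous_on UNIV ?f"
    by (intro continuous_intros)
  then have [measurable]: "?f \<in> borel_measurable borel"
    by (rule borel_measurable_continuous_onI)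
  obtain R where R: "\<And>k. k \<in> K \<Longrightarrow> norm k \<le> R"
    using assms(2) by (auto simp: bounded_iff)
  \<comment> \<open>From \<open>norm x \<le> d + R\<close> and
    \<open>(d + R)\<^sup>2 \<le> 2 * d\<^sup>2 + 2 * R\<^sup>2\<close>, with \<open>d\<close> the
    distance to \<open>K\<close>; the factor 2 is the reason for \<open>pi / 2\<close>.\<close>
  have le: "?f x \<le> exp (pi * R\<^sup>2) * exp (- (pi / 2) * (norm x)\<^sup>2)" for x
  proof -
    have "norm x - R \<le> infdist x K"
      unfolding infdist_notempty[OF assms(1)]
    proof (rule cINF_greatest[OF assms(1)])
      fix k assume "k \<in> K"
      then show "norm x - R \<le> dist x k"
        using R[of k] norm_triangle_sub[of x k] by (simp add: dist_norm)
    qed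
    have "norm x \<le> infdist x K + R"
      using \<open>norm x - R \<le> infdist x K\<close> by simp
    then have "(norm x)\<^sup>2 \<le> (infdist x K + R)\<^sup>2"
      by (intro power_mono) auto
    also have "\<dots> \<le> 2 * (infdist x K)\<^sup>2 + 2 * R\<^sup>2"
      using sum_squares_ge_zero[of "infdist x K - R" 0] by (simp add: power2_eq_square algebra_simps)
    finally have "pi * (norm x)\<^sup>2 \<le> pi * (2 * (infdist x K)\<^sup>2 + 2 * R\<^sup>2)"
      by (intro mult_left_mono) auto
    then show ?thesis
      unfolding exp_add[symmetric] by (simp add: algebra_simps)
  qed
  have "(\<integral>\<^sup>+x. ?f x \<partial>lborel) \<le> (\<integral>\<^sup>+x. ennreal (exp (pi * R\<^sup>2)) * ennreal (exp (- (pi / 2) * (norm x)\<^sup>2)) \<partial>(lborel :: 'a measure))"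
    using le by (intro nn_integral_mono) (simp flip: ennreal_mult'')
  also have "\<dots> = ennreal (exp (pi * R\<^sup>2)) * ennreal (sqrt (pi / (pi / 2)) ^ DIM('a))"
    using nn_integral_gaussian[of "pi / 2", where 'a = 'a] by (subst nn_integral_cmult) simp_all
  also have "\<dots> < \<infinity>"
    by (simp add: ennreal_mult_less_top)
  finally have "integrable lborel ?f"
    using \<open>?f \<in> borel_measurable borel\<close> by (intro integrableI_bounded) auto
  then have "(?f has_integral (\<integral>x. ?f x \<partial>lborel)) UNIV"
    by (rule has_integral_integral_lborel)
  then have "integral UNIV ?f = (\<integral>x. ?f x \<partial>lborel)" and int: "?f integrable_on UNIV"
    by (auto simp: has_integral_iff)
  then have "wills K = (\<integral>x. ?f x \<partial>lborel)"
    by (simp add: wills_def)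
  then show "(\<integral>\<^sup>+x. ?f x \<partial>lborel) = wills K"
    using nn_integral_eq_integral[OF \<open>integrable lborel ?f\<close>] by simp
  show "?f integrable_on UNIV"
    by (rule int)
qed

text \<open>Holds for every set because the integral of a non-integrable function is 0 by
  convention.\<close>

lemma wills_nonneg: "wills K \<ge> 0"
  unfolding wills_def by (cases "(\<lambda>x. exp (- pi * (infdist x K)\<^sup>2)) integrable_on UNIV")
    (auto intro: integral_nonneg simp: not_integrable_integral)

lemma wills_mono:
  fixes K L :: "'a::euclidean_space set"
  assumes "K \<subseteq> L" "K \<noteq> {}" "bounded L"
  shows "wills K \<le> wills L"
  unfolding wills_def
proof (rule integral_le)
  fix x
  show "exp (- pi * (infdist x K)\<^sup>2) \<le> exp (- pi * (infdist x L)\<^sup>2)"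
    using power_mono[OF infdist_mono[OF assms(1,2)] infdist_nonneg, of x 2] by simp
qed (use assms bounded_subset nn_integral_wills(2) in blast)+

lemma wills_superlevel:
  assumes "0 < u" "u < 1"
  shows "{x. u < exp (- pi * (infdist x K)\<^sup>2)} = nbhd (sqrt (- ln u / pi)) K"
proof -
  have "u < exp (- pi * d\<^sup>2) \<longleftrightarrow> d < sqrt (- ln u / pi)" if "d \<ge> 0" for d
  proof -
    have "u < exp (- pi * d\<^sup>2) \<longleftrightarrow> ln u < - pi * d\<^sup>2"
      using assms by (metis exp_gt_zero ln_exp ln_less_cancel_iff)
    also have "\<dots> \<longleftrightarrow> d\<^sup>2 < - ln u / pi"
      by (subst pos_less_divide_eq) (auto simp: mult.commute)
    also have "\<dots> \<longleftrightarrow> d < sqrt (- ln u / pi)"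
      using that real_sqrt_less_iff[of "d\<^sup>2" "- ln u / pi"] by (simp del: real_sqrt_less_iff)
    finally show ?thesis .
  qed
  then show ?thesis
    by (auto simp: nbhd_def infdist_nonneg)
qed

lemma wills_layer_cake:
  fixes K :: "'a::euclidean_space set"
  assumes "K \<noteq> {}" "bounded K"
  shows "ennreal (wills K)
    = (\<integral>\<^sup>+u. indicator {0<..<1} u * ennreal (measure lborel (nbhd (sqrt (- ln u / pi)) K)) \<partial>lborel)"
proof -
  have "continuous_on UNIV (\<lambda>x. exp (- pi * (infdist x K)\<^sup>2))"
    by (intro continuous_intros)
  then have "ennreal (wills K) = (\<integral>\<^sup>+u. indicator {0<..<1} u *
      emeasure lborel {x. u < exp (- pi * (infdist x K)\<^sup>2)} \<partial>lborel)"
    unfolding nn_integral_wills(1)[OF assms, symmetric]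
    by (intro layer_cake borel_measurable_continuous_onI) auto
  also have "\<dots> = (\<integral>\<^sup>+u. indicator {0<..<1} u * ennreal (measure lborel (nbhd (sqrt (- ln u / pi)) K)) \<partial>lborel)"
  proof (intro nn_integral_cong)
    fix u :: real
    have "emeasure lborel {x. u < exp (- pi * (infdist x K)\<^sup>2)}
        = ennreal (measure lborel (nbhd (sqrt (- ln u / pi)) K))" if "0 < u" "u < 1"
      by (simp only: wills_superlevel[OF that] emeasure_eq_measure2[OF nbhd_fmeasurable[OF assms]])
    then show "indicator {0<..<1} u * emeasure lborel {x. u < exp (- pi * (infdist x K)\<^sup>2)}
        = indicator {0<..<1} u * ennreal (measure lborel (nbhd (sqrt (- ln u / pi)) K))"
      by (cases "u \<in> {0<..<1}") simp_all
  qed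
  finally show ?thesis .
qed

section \<open>Comparison with the volume profile of a point\<close>

text \<open>The layer formula for a single point: its neighbourhoods are balls, and its Wills
  functional is the Gaussian integral with \<open>c = pi\<close>, which is 1.\<close>

lemma nn_integral_ball_layers:
  "(\<integral>\<^sup>+u. indicator {0<..<1} u * ennreal (unit_ball_vol (real DIM('a::euclidean_space))
      * sqrt (- ln u / pi) ^ DIM('a)) \<partial>lborel) = 1"
proof -
  have nb: "nbhd s {0} = ball (0 :: 'a) s" for s
    by (auto simp: nbhd_def)
  have "ennreal (wills {0 :: 'a}) = 1"
    using nn_integral_gaussian[of pi, where 'a = 'a] nn_integral_wills(1)[of "{0 :: 'a}"] by simp
  then have "1 = (\<integral>\<^sup>+u. indicator {0<..<1} u * ennreal (measure lborel (ball (0 :: 'a) (sqrt (- ln u / pi)))) \<partial>lborel)"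
    by (subst (asm) wills_layer_cake) (simp_all add: nb)
  also have "\<dots> = (\<integral>\<^sup>+u. indicator {0<..<1} u * ennreal (unit_ball_vol (real DIM('a)) * sqrt (- ln u / pi) ^ DIM('a)) \<partial>lborel)"
    by (intro nn_integral_cong) (auto split: split_indicator simp: content_ball divide_nonpos_pos)
  finally show ?thesis ..
qed

lemma nn_integral_affine_layers:
  assumes "a \<ge> 0" "b \<ge> 0"
  shows "(\<integral>\<^sup>+u. indicator {0<..<1} u * ennreal (a + b * (unit_ball_vol (real DIM('a::euclidean_space))
      * sqrt (- ln u / pi) ^ DIM('a))) \<partial>lborel) = ennreal (a + b)"
proof -
  let ?h = "\<lambda>u. unit_ball_vol (real DIM('a)) * sqrt (- ln u / pi) ^ DIM('a)"
  have h: "?h u \<ge> 0" if "u \<in> {0<..<1}" for u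
    using that by (simp add: divide_nonpos_pos)
  have "(\<integral>\<^sup>+u. indicator {0<..<1} u * ennreal (a + b * ?h u) \<partial>lborel)
    = (\<integral>\<^sup>+u. ennreal a * indicator {0<..<1} u + ennreal b * (indicator {0<..<1} u * ennreal (?h u)) \<partial>lborel)"
  proof (intro nn_integral_cong)
    fix u :: real
    show "indicator {0<..<1} u * ennreal (a + b * ?h u)
        = ennreal a * indicator {0<..<1} u + ennreal b * (indicator {0<..<1} u * ennreal (?h u))"
      using assms h[of u] by (cases "u \<in> {0<..<1}")
        (simp_all only: indicator_simps ennreal_plus ennreal_mult mult_nonneg_nonneg mult_1 mult_1_right
          mult_zero_left mult_zero_right add_0, simp_all)
  qed
  also have "\<dots> = ennreal a * emeasure lborel {0<..<1::real}
      + ennreal b * (\<integral>\<^sup>+u. indicator {0<..<1} u * ennreal (?h u) \<partial>lborel)"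
    by (subst nn_integral_add, simp, simp, subst nn_integral_cmult, simp, subst nn_integral_cmult, simp) simp
  also have "\<dots> = ennreal (a + b)"
    using assms nn_integral_ball_layers[where 'a = 'a] by simp
  finally show ?thesis .
qed

text \<open>The hypothesis on \<open>r\<close> gives
  \<open>(s / r) ^ n \<le> \<kappa> * s ^ n\<close>, the volume of a ball of radius
  \<open>s\<close>. So the mixture bound is at most a constant plus a multiple of the profile of a
  point, and the weights \<theta> and 1 - \<theta> integrate to 1.\<close>

lemma wills_le_measure_nbhd:
  fixes K :: "'a::euclidean_space set"
  assumes "K \<noteq> {}" "bounded K" "convex K" "r > 0" and r: "unit_ball_vol (real DIM('a)) * r ^ DIM('a) \<ge> 1"
  shows "wills K \<le> measure lborel (nbhd r K)"
proof -
  let ?V = "measure lborel (nbhd r K)" and ?n = "DIM('a)" and ?\<kappa> = "unit_ball_vol (real DIM('a))"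
  let ?s = "\<lambda>u. sqrt (- ln u / pi)"
  obtain \<theta> where th: "0 \<le> \<theta>" "\<theta> \<le> 1"
    and le: "\<And>s. s > 0 \<Longrightarrow> measure lborel (nbhd s K) \<le> ?V * (\<theta> + (1 - \<theta>) * (s / r) ^ ?n)"
    using measure_nbhd_le_mixture[OF assms(1-4)] by metis
  have "measure lborel (nbhd (?s u) K) \<le> ?V * \<theta> + ?V * (1 - \<theta>) * (?\<kappa> * ?s u ^ ?n)"
    if "u \<in> {0<..<1}" for u
  proof -
    have s: "?s u > 0"
      using that by (simp add: divide_neg_pos)
    have "(?s u / r) ^ ?n \<le> (?s u / r) ^ ?n * (?\<kappa> * r ^ ?n)"
      using mult_left_mono[OF r, of "(?s u / r) ^ ?n"] s assms(4) by simp
    also have "\<dots> = ?\<kappa> * ?s u ^ ?n"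
      using assms(4) by (simp add: power_divide)
    finally have "?V * (\<theta> + (1 - \<theta>) * (?s u / r) ^ ?n) \<le> ?V * (\<theta> + (1 - \<theta>) * (?\<kappa> * ?s u ^ ?n))"
      using th by (intro mult_left_mono add_mono) auto
    then show ?thesis
      using le[OF s] by (simp add: algebra_simps)
  qed
  then have "ennreal (wills K) \<le> (\<integral>\<^sup>+u. indicator {0<..<1} u * ennreal (?V * \<theta> + ?V * (1 - \<theta>) * (?\<kappa> * ?s u ^ ?n)) \<partial>lborel)"
    unfolding wills_layer_cake[OF assms(1,2)]
    by (intro nn_integral_mono) (auto split: split_indicator intro!: ennreal_leI)
  also have "\<dots> = ennreal (?V * \<theta> + ?V * (1 - \<theta>))"
    using th by (intro nn_integral_affine_layers) auto
  also have "\<dots> = ennreal ?V"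
    by (simp add: algebra_simps)
  finally show ?thesis
    by (simp add: ennreal_le_iff)
qed

section \<open>Lower bounds for the Wills functional\<close>

text \<open>The Gaussian of the distance dominates the step function with values
  \<open>E s\<^sub>1\<close>, \<open>E s\<^sub>2\<close>, \<open>E s\<^sub>3\<close> on the nested
  neighbourhoods, written as a sum of indicators with the successive differences as heights.\<close>

lemma three_step_le_wills:
  fixes K :: "'a::euclidean_space set"
  assumes "K \<noteq> {}" "bounded K" and s: "0 \<le> s\<^sub>1" "s\<^sub>1 \<le> s\<^sub>2" "s\<^sub>2 \<le> s\<^sub>3"
  defines "E \<equiv> \<lambda>s. exp (- pi * s\<^sup>2)"
  shows "(E s\<^sub>1 - E s\<^sub>2) * measure lborel (nbhd s\<^sub>1 K) + (E s\<^sub>2 - E s\<^sub>3) * measure lborel (nbhd s\<^sub>2 K)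
    + E s\<^sub>3 * measure lborel (nbhd s\<^sub>3 K) \<le> wills K"
proof -
  have E: "E t \<le> E s" if "0 \<le> s" "s \<le> t" for s t
    using power_mono[OF that(2,1), of 2] by (simp add: E_def)
  define a b c where "a = E s\<^sub>1 - E s\<^sub>2" and "b = E s\<^sub>2 - E s\<^sub>3" and "c = E s\<^sub>3"
  have abc: "a \<ge> 0" "b \<ge> 0" "c \<ge> 0"
    unfolding a_def b_def c_def using s by (auto simp: E intro: order_trans) (simp add: E_def)
  let ?i = "\<lambda>s x. indicator (nbhd s K) x :: real"
  have le: "a * ?i s\<^sub>1 x + b * ?i s\<^sub>2 x + c * ?i s\<^sub>3 x \<le> E (infdist x K)" for x
  proof -
    have "E (infdist x K) \<ge> 0"
      by (simp add: E_def)
    then show ?thesis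
      using s E[of "infdist x K" s\<^sub>1] E[of "infdist x K" s\<^sub>2] E[of "infdist x K" s\<^sub>3] infdist_nonneg[of x K]
      by (auto simp: nbhd_def indicator_def a_def b_def c_def)
  qed
  have m: "emeasure lborel (nbhd s K) = ennreal (measure lborel (nbhd s K))" for s
    using nbhd_fmeasurable[OF assms(1,2)] by (rule emeasure_eq_measure2)
  have [measurable]: "nbhd s K \<in> sets borel" for s
    by (rule borel_open[OF open_nbhd])
  have "ennreal (a * measure lborel (nbhd s\<^sub>1 K) + b * measure lborel (nbhd s\<^sub>2 K) + c * measure lborel (nbhd s\<^sub>3 K))
    = (\<integral>\<^sup>+x. ennreal a * indicator (nbhd s\<^sub>1 K) x + ennreal b * indicator (nbhd s\<^sub>2 K) x
        + ennreal c * indicator (nbhd s\<^sub>3 K) x \<partial>lborel)"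
    using abc by (simp add: nn_integral_add nn_integral_cmult m ennreal_mult ennreal_plus)
  also have "\<dots> = (\<integral>\<^sup>+x. ennreal (a * ?i s\<^sub>1 x + b * ?i s\<^sub>2 x + c * ?i s\<^sub>3 x) \<partial>lborel)"
    using abc by (intro nn_integral_cong) (auto split: split_indicator simp: ennreal_plus)
  also have "\<dots> \<le> (\<integral>\<^sup>+x. ennreal (E (infdist x K)) \<partial>lborel)"
    using le by (intro nn_integral_mono ennreal_leI)
  also have "\<dots> = ennreal (wills K)"
    unfolding E_def by (rule nn_integral_wills(1)[OF assms(1,2)])
  finally show ?thesis
    using wills_nonneg[of K] by (simp add: ennreal_le_iff a_def b_def c_def)
qed

lemma exp_measure_nbhd_le_wills:
  fixes K :: "'a::euclidean_space set"
  assumes "K \<noteq> {}" "bounded K" "0 \<le> s"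
  shows "exp (- pi * s\<^sup>2) * measure lborel (nbhd s K) \<le> wills K"
  \<comment> \<open>With three equal radii the two differences vanish.\<close>
  using three_step_le_wills[OF assms order_refl order_refl] by simp

text \<open>The ball of radius \<open>sqrt n / 2\<close> contains the centred cube of side
  1.\<close>

lemma unit_ball_vol_sqrt_DIM:
  "unit_ball_vol (real DIM('a::euclidean_space)) * (sqrt DIM('a) / 2) ^ DIM('a) \<ge> 1"
proof -
  let ?h = "(1 / 2) *\<^sub>R One :: 'a"
  have "cbox (- ?h) ?h \<subseteq> cball 0 (sqrt DIM('a) / 2)"
  proof
    fix x assume x: "x \<in> cbox (- ?h) ?h"
    have "(norm x)\<^sup>2 = (\<Sum>i\<in>Basis. (x \<bullet> i)\<^sup>2)"
      unfolding power2_norm_eq_inner euclidean_inner[of x x] by (simp add: power2_eq_square)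
    also have "\<dots> \<le> (\<Sum>i\<in>(Basis :: 'a set). (1 / 2)\<^sup>2)"
      using x by (intro sum_mono abs_le_square_iff[THEN iffD1]) (auto simp: mem_box abs_le_iff)
    also have "\<dots> = (sqrt DIM('a) / 2)\<^sup>2"
      by (simp add: power_divide)
    finally show "x \<in> cball 0 (sqrt DIM('a) / 2)"
      by (simp add: power2_le_iff_abs_le)
  qed
  then have "measure lborel (cbox (- ?h) ?h) \<le> measure lborel (cball (0 :: 'a) (sqrt DIM('a) / 2))"
    by (intro measure_mono_fmeasurable) (auto simp: fmeasurable_def intro: emeasure_compact_finite[unfolded infinity_ennreal_def])
  moreover have "measure lborel (cbox (- ?h) ?h) = 1"
  proof -
    have "?h - - ?h = One"
      by (simp flip: scaleR_add_left)
    then have "measure lborel (cbox (- ?h) ?h) = (\<Prod>b\<in>Basis. One \<bullet> (b :: 'a))"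
      using measure_lborel_cbox[of "- ?h" ?h] by simp
    then show ?thesis
      by (simp add: prod.neutral)
  qed
  ultimately show ?thesis
    by (simp add: content_cball)
qed

section \<open>Dimensions one and two\<close>

text \<open>The only basis vector identifies the space with the real line, where \<open>K\<close>
  becomes an interval of length \<open>l\<close>.\<close>

lemma measure_nbhd_DIM_1:
  fixes K :: "'a::euclidean_space set"
  assumes "DIM('a) = 1" "K \<noteq> {}" "bounded K" "convex K"
  obtains l where "l \<ge> 0" "\<And>s. s > 0 \<Longrightarrow> measure lborel (nbhd s K) = l + 2 * s"
proof -
  obtain e :: 'a where e: "Basis = {e}"
    using assms(1) by (metis card_1_singletonE)
  have ee: "norm e = 1"
    using e norm_Basis by blast
  have rep: "x = (x \<bullet> e) *\<^sub>R e" for x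
    using euclidean_representation[of x] by (simp add: e)
  have dist: "dist x y = \<bar>x \<bullet> e - y \<bullet> e\<bar>" for x y
    using arg_cong[OF rep[of "x - y"], of norm] by (simp add: dist_norm ee inner_diff_left)
  let ?P = "(\<lambda>x. x \<bullet> e) ` K"
  obtain R where "\<And>k. k \<in> K \<Longrightarrow> norm k \<le> R"
    using assms(3) by (auto simp: bounded_iff)
  then have "\<bar>k \<bullet> e\<bar> \<le> R" if "k \<in> K" for k
    using that Cauchy_Schwarz_ineq2[of k e] ee by (metis mult.right_neutral order_trans)
  then have R: "- R \<le> k \<bullet> e" "k \<bullet> e \<le> R" if "k \<in> K" for k
    using that by (auto simp: abs_le_iff minus_le_iff)
  then have bd: "bdd_below ?P" "bdd_above ?P"
    by (auto intro!: bdd_belowI2[of _ "- R"] bdd_aboveI2[of _ _ R])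
  have ne: "?P \<noteq> {}"
    using assms by simp
  have "convex ?P"
    using assms(4) by (intro convex_linear_image) (auto intro: bounded_linear.linear bounded_linear_inner_left)
  then have "is_interval ?P"
    by (simp add: is_interval_convex_1)
  define m M where "m = Inf ?P" and "M = Sup ?P"
  have mM: "m \<le> k \<bullet> e" "k \<bullet> e \<le> M" if "k \<in> K" for k
    unfolding m_def M_def using that bd by (auto intro: cInf_lower cSup_upper)
  have "m \<le> M"
    using mM assms(2) by fastforce
  have "nbhd s K = box ((m - s) *\<^sub>R e) ((M + s) *\<^sub>R e)" if "s > 0" for s
  proof (intro set_eqI)
    fix x
    have "x \<in> nbhd s K \<longleftrightarrow> (\<exists>k\<in>K. \<bar>x \<bullet> e - k \<bullet> e\<bar> < s)"
      by (simp add: mem_nbhd_iff[OF assms(2)] dist)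
    also have "\<dots> \<longleftrightarrow> m - s < x \<bullet> e \<and> x \<bullet> e < M + s"
    proof
      assume "\<exists>k\<in>K. \<bar>x \<bullet> e - k \<bullet> e\<bar> < s"
      then show "m - s < x \<bullet> e \<and> x \<bullet> e < M + s"
        using mM by (force simp: abs_less_iff)
    next
      assume x: "m - s < x \<bullet> e \<and> x \<bullet> e < M + s"
      \<comment> \<open>Points of \<open>K\<close> almost reaching the infimum and the supremum:
        either \<open>x\<close> lies between them, hence in \<open>K\<close>, or it is within
        \<open>s\<close> of one of them.\<close>
      obtain k where k: "k \<in> K" "k \<bullet> e < x \<bullet> e + s"
        using x cInf_lessD[OF ne, of "x \<bullet> e + s"] unfolding m_def by auto
      obtain k' where k': "k' \<in> K" "k' \<bullet> e > x \<bullet> e - s"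
        using x less_cSupD[OF ne, of "x \<bullet> e - s"] unfolding M_def by auto
      show "\<exists>k\<in>K. \<bar>x \<bullet> e - k \<bullet> e\<bar> < s"
      proof (cases "k \<bullet> e \<le> x \<bullet> e \<and> x \<bullet> e \<le> k' \<bullet> e")
        case True
        then have "x \<bullet> e \<in> ?P"
          using \<open>is_interval ?P\<close> k(1) k'(1) unfolding is_interval_1 by blast
        then show ?thesis
          using that by force
      next
        case False
        then show ?thesis
          using k k' by (force simp: abs_less_iff)
      qed
    qed
    also have "\<dots> \<longleftrightarrow> x \<in> box ((m - s) *\<^sub>R e) ((M + s) *\<^sub>R e)"
      using ee by (simp add: mem_box e norm_eq_1)
    finally show "x \<in> nbhd s K \<longleftrightarrow> x \<in> box ((m - s) *\<^sub>R e) ((M + s) *\<^sub>R e)" .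
  qed
  then have "measure lborel (nbhd s K) = (M - m) + 2 * s" if "s > 0" for s
    using that \<open>m \<le> M\<close> ee by (simp add: measure_lborel_box_eq e norm_eq_1 inner_diff_left)
  then show thesis
    using that[of "M - m"] \<open>m \<le> M\<close> by simp
qed

text \<open>A ball of radius \<open>s\<close> has volume \<open>2 * s\<close> here, so
  \<open>l + 2 * s\<close> is \<open>l\<close> plus the profile of a point and integrates to
  \<open>l + 1\<close>, its own value at \<open>s = 1 / 2\<close>.\<close>

lemma wills_DIM_1:
  fixes K :: "'a::euclidean_space set"
  assumes "DIM('a) = 1" "K \<noteq> {}" "bounded K" "convex K"
  shows "wills K = measure lborel (nbhd (1 / 2) K)"
proof -
  obtain l where l: "l \<ge> 0" "\<And>s. s > 0 \<Longrightarrow> measure lborel (nbhd s K) = l + 2 * s"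
    using measure_nbhd_DIM_1[OF assms] by metis
  have "ennreal (wills K) = (\<integral>\<^sup>+u. indicator {0<..<1} u * ennreal (l + 1 * (unit_ball_vol (real DIM('a))
      * sqrt (- ln u / pi) ^ DIM('a))) \<partial>lborel)"
    unfolding wills_layer_cake[OF assms(2,3)]
    using l(2) assms(1) by (intro nn_integral_cong) (auto split: split_indicator simp: divide_neg_pos)
  also have "\<dots> = ennreal (l + 1)"
    using l by (intro nn_integral_affine_layers) auto
  finally show ?thesis
    using l wills_nonneg[of K] by (subst (asm) ennreal_inj) auto
qed

text \<open>Comparing with the indicator function of one neighbourhood would only give the constant
  \<open>exp 1 > 2\<close>; three nested neighbourhoods suffice.\<close>

lemma measure_nbhd_le_2_wills_DIM_2:
  fixes K :: "'a::euclidean_space set"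
  assumes "DIM('a) = 2" "K \<noteq> {}" "bounded K" "convex K"
  shows "measure lborel (nbhd (1 / sqrt pi) K) \<le> 2 * wills K"
proof -
  let ?V = "measure lborel (nbhd (1 / sqrt pi) K)"
  \<comment> \<open>At these radii the Gaussian is \<open>exp (- c)\<close>, and contraction by
    \<open>sqrt c\<close> keeps at least the fraction \<open>c\<close> of the area
    \<open>?V\<close>.\<close>
  define s where "s c = sqrt c * (1 / sqrt pi)" for c
  define E where "E c = exp (- pi * (s c)\<^sup>2)" for c
  have s: "0 \<le> s (1 / 3)" "s (1 / 3) \<le> s (2 / 3)" "s (2 / 3) \<le> s 1"
    by (auto simp: s_def intro!: divide_right_mono)
  have E: "E c = exp (- c)" if "0 \<le> c" for c
    using that by (simp add: E_def s_def power_divide)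
  have V: "c * ?V \<le> measure lborel (nbhd (s c) K)" if "0 < c" "c \<le> 1" for c
    using measure_nbhd_ge_scaled[OF assms(2-4), of "sqrt c" "1 / sqrt pi"] that assms(1)
    by (simp add: s_def)
  \<comment> \<open>From \<open>exp (- (1 / 6)) \<ge> 5 / 6\<close>, whose square is
    \<open>25 / 36\<close>.\<close>
  have q: "exp (- (k / 3)) \<ge> (25 / 36) ^ k" for k :: nat
  proof -
    have "(5 / 6 :: real) \<le> exp (- (1 / 6))"
      using exp_ge_add_one_self[of "- (1 / 6)"] by simp
    then have "(5 / 6 :: real) ^ (2 * k) \<le> exp (- (1 / 6)) ^ (2 * k)"
      by (rule power_mono) simp
    then show ?thesis
      by (simp add: power_mult power2_eq_square flip: exp_of_nat_mult exp_add)
  qed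
  have ex: "exp (- (1 / 3)) \<ge> (25 / 36 :: real)" "exp (- (2 / 3)) \<ge> (625 / 1296 :: real)"
    "exp (- 1) \<ge> (15625 / 46656 :: real)"
    using q[of 1] q[of 2] q[of 3] by (simp_all add: power2_eq_square power3_eq_cube)
  \<comment> \<open>The mean of the three bounds is about 0.504, just above one half.\<close>
  have "1 / 2 * ?V \<le> (25 / 36 + 625 / 1296 + 15625 / 46656) / 3 * ?V"
    by (intro mult_right_mono) auto
  also have "\<dots> \<le> (E (1/3) + E (2/3) + E 1) / 3 * ?V"
    using ex by (intro mult_right_mono divide_right_mono add_mono) (auto simp: E)
  \<comment> \<open>Summation by parts turns the mean of the heights into the weights of the step
    function.\<close>
  also have "\<dots> = (E (1/3) - E (2/3)) * (1/3 * ?V) + (E (2/3) - E 1) * (2/3 * ?V) + E 1 * (1 * ?V)"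
    by (simp add: field_simps)
  also have "\<dots> \<le> (E (1/3) - E (2/3)) * measure lborel (nbhd (s (1/3)) K)
      + (E (2/3) - E 1) * measure lborel (nbhd (s (2/3)) K) + E 1 * measure lborel (nbhd (s 1) K)"
    by (intro add_mono mult_left_mono V) (auto simp: E)
  also have "\<dots> \<le> wills K"
    unfolding E_def by (intro three_step_le_wills assms s)
  finally show ?thesis
    by simp
qed

section \<open>Numerical bounds for \<open>pi\<close> and \<open>exp\<close>\<close>

text \<open>The point \<open>21 / 40\<close> is a sixth of 3.15; its sine exceeds
  \<open>1 / 2 = sin (pi / 6)\<close> by the Taylor polynomial of degree 3 with remainder.\<close>

lemma pi_less_315: "pi < 3 + 3 / 20"
proof (rule ccontr)
  let ?x = "21 / 40 :: real"
  assume "\<not> pi < 3 + 3 / 20"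
  then have "sin ?x \<le> sin (pi / 6)"
    by (intro sin_monotone_2pi_le) auto
  moreover have "sin ?x \<ge> (\<Sum>m<5. sin_coeff m * ?x ^ m) - inverse (fact 5) * \<bar>?x\<bar> ^ 5"
    using Maclaurin_sin_bound[of ?x 5] by (simp only: abs_le_iff) linarith
  moreover have "(\<Sum>m<5. sin_coeff m * ?x ^ m) = ?x - ?x ^ 3 / 6"
  proof -
    have "{..<5} = {0, 1, 2, 3, 4 :: nat}"
      by auto
    then show ?thesis
      by (simp add: sin_coeff_def fact_numeral)
  qed
  ultimately show False
    by (simp add: sin_30 fact_numeral power_divide)
qed

text \<open>The exponent is \<open>pi * r\<^sup>2\<close> for \<open>r = sqrt n / 2\<close>. The
  base case is \<open>exp pi \<le> 24\<close>; afterwards the left side grows by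
  \<open>exp (pi / 4)\<close>, less than \<open>n + 1\<close>.\<close>

lemma exp_quarter_pi_le_fact:
  assumes "n \<ge> 4"
  shows "exp (pi * n / 4) \<le> fact n"
  using assms
proof (induction n rule: dec_induct)
  case base
  have pi: "pi \<le> 3 + 3 / 20"
    using pi_less_315 by simp
  \<comment> \<open>Upper bounds for \<open>exp\<close> come from
    \<open>1 - x \<le> exp (- x)\<close> by taking reciprocals.\<close>
  have "exp (3 / 20) * (1 - 3 / 20) \<le> exp (3 / 20) * exp (- (3 / 20 :: real))"
    using exp_ge_add_one_self[of "- (3 / 20)"] by (intro mult_left_mono) auto
  then have "exp (3 / 20 :: real) \<le> 20 / 17"
    by (simp flip: exp_add)
  moreover have "exp (1 :: real) ^ 3 \<le> (272 / 100) ^ 3"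
    using e_less_272 by (intro power_mono) auto
  ultimately have le: "exp (1 :: real) ^ 3 * exp (3 / 20) \<le> (272 / 100) ^ 3 * (20 / 17)"
    by (intro mult_mono) auto
  have "exp pi \<le> exp (3 + 3 / 20)"
    using pi by (simp only: exp_le_cancel_iff)
  also have "\<dots> = exp (1 :: real) ^ 3 * exp (3 / 20)"
    unfolding exp_add by (simp flip: exp_of_nat_mult)
  also note le
  also have "(272 / 100) ^ 3 * (20 / 17) \<le> (24 :: real)"
    by (simp add: power3_eq_cube)
  finally have "exp pi \<le> 24" .
  then show ?case
    by (simp add: fact_numeral)
next
  case (step n)
  have "exp (pi / 4) \<le> exp (1 :: real)"
    using pi_less_4 by simp
  also have "\<dots> \<le> real (Suc n)"
    using e_less_272 step by simp
  finally have "exp (pi / 4) * exp (pi * n / 4) \<le> real (Suc n) * fact n"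
    using step by (intro mult_mono) auto
  then show ?case
    by (simp add: field_simps flip: exp_add)
qed

section \<open>The inequality for p-sums\<close>

text \<open>The left inequality wants \<open>r\<close> large, the right one wants it small. From
  dimension 3 on, \<open>exp (pi * r\<^sup>2) \<le> n!\<close> settles the right one:
  \<open>sqrt n / 2\<close> works for \<open>n \<ge> 4\<close> and \<open>1 / sqrt 2\<close> for
  \<open>n = 3\<close>. Dimensions 1 and 2 use the radius of the ball of volume 1 and their own
  finer estimates.\<close>

lemma wills_equivalent_measure_nbhd:
  obtains r where "r > 0"
    "\<And>K :: 'a::euclidean_space set. convex_body K \<Longrightarrow> wills K \<le> measure lborel (nbhd r K)"
    "\<And>K :: 'a set. convex_body K \<Longrightarrow> measure lborel (nbhd r K) \<le> fact DIM('a) * wills K"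
proof -
  let ?n = "DIM('a)" and ?\<kappa> = "unit_ball_vol (real DIM('a))"
  have "\<exists>r>0. ?\<kappa> * r ^ ?n \<ge> 1 \<and>
    (\<forall>K :: 'a set. convex_body K \<longrightarrow> measure lborel (nbhd r K) \<le> fact ?n * wills K)"
  proof -
    have body: "K \<noteq> {}" "bounded K" "convex K" if "convex_body K" for K :: "'a set"
      using that by (auto simp: convex_body_def compact_imp_bounded)
    have large: "measure lborel (nbhd r K) \<le> fact ?n * wills K"
      if "r \<ge> 0" "exp (pi * r\<^sup>2) \<le> fact ?n" "convex_body K" for r and K :: "'a set"
    proof -
      have "measure lborel (nbhd r K) = exp (pi * r\<^sup>2) * (exp (- pi * r\<^sup>2) * measure lborel (nbhd r K))"
        by (simp add: exp_minus)
      also have "\<dots> \<le> fact ?n * wills K"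
        using that body[OF that(3)] by (intro mult_mono exp_measure_nbhd_le_wills) auto
      finally show ?thesis .
    qed
    have "?n > 0" by simp
    then consider "?n = 1" | "?n = 2" | "?n = 3" | "?n \<ge> 4"
      by linarith
    then show ?thesis
    proof cases
      case 1
      then have "measure lborel (nbhd (1 / 2) K) \<le> fact ?n * wills K" if "convex_body K" for K :: "'a set"
        using wills_DIM_1[of K] body[OF that] by simp
      then show ?thesis
        using 1 by (intro exI[of _ "1 / 2"]) simp
    next
      case 2
      then have "measure lborel (nbhd (1 / sqrt pi) K) \<le> fact ?n * wills K" if "convex_body K" for K :: "'a set"
        using measure_nbhd_le_2_wills_DIM_2[of K] body[OF that] by (simp add: fact_numeral)
      then show ?thesis
        using 2 by (intro exI[of _ "1 / sqrt pi"]) (simp add: unit_ball_vol_2 power_divide)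
    next
      case 3
      \<comment> \<open>Uses \<open>pi / 2 \<le> 8 / 5\<close> and
        \<open>exp (1 / 5) \<le> 5 / 4\<close>; the eighth power of \<open>5 / 4\<close> is about
        5.96.\<close>
      have "exp (pi / 2) \<le> 6"
      proof -
        have "exp (pi / 2) \<le> exp (8 * (1 / 5))"
          using pi_less_315 by simp
        also have "\<dots> = exp (1 / 5 :: real) ^ 8"
          by (simp flip: exp_of_nat_mult)
        also have "\<dots> \<le> (5 / 4) ^ 8"
        proof (rule power_mono)
          have "exp (1 / 5) * (4 / 5) \<le> exp (1 / 5) * exp (- (1 / 5 :: real))"
            using exp_ge_add_one_self[of "- (1 / 5)"] by (intro mult_left_mono) auto
          then show "exp (1 / 5 :: real) \<le> 5 / 4"
            by (simp flip: exp_add)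
        qed simp
        finally show ?thesis
          by (simp add: power_divide)
      qed
      then have "measure lborel (nbhd (1 / sqrt 2) K) \<le> fact ?n * wills K" if "convex_body K" for K :: "'a set"
        using 3 that by (intro large) (auto simp: power_divide fact_numeral)
      moreover have "?\<kappa> * (1 / sqrt 2) ^ ?n \<ge> 1"
      proof -
        have "?\<kappa> * (1 / sqrt 2) ^ ?n = 2 * pi / (3 * sqrt 2)"
          using 3 by (simp add: unit_ball_vol_3 power3_eq_cube field_simps)
        moreover have "3 * sqrt 2 \<le> 2 * pi"
        proof -
          have "sqrt 2 \<le> 3 / 2"
            by (rule real_le_lsqrt) (auto simp: power2_eq_square)
          \<comment> \<open>Otherwise
            \<open>1 / 2 = sin (pi / 6) < sin (1 / 2) \<le> 1 / 2\<close>.\<close>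
          moreover have "3 \<le> pi"
          proof (rule ccontr)
            assume "\<not> 3 \<le> pi"
            then have "sin (pi / 6) < sin (1 / 2)"
              by (intro sin_monotone_2pi) (use pi_ge_two in auto)
            then show False
              using sin_x_le_x[of "1 / 2"] by (simp add: sin_30)
          qed
          ultimately show ?thesis by linarith
        qed
        ultimately show ?thesis
          by simp
      qed
      ultimately show ?thesis
        by (intro exI[of _ "1 / sqrt 2"]) simp
    next
      case 4
      then have "measure lborel (nbhd (sqrt ?n / 2) K) \<le> fact ?n * wills K" if "convex_body K" for K :: "'a set"
        using that exp_quarter_pi_le_fact[OF 4] by (intro large) (auto simp: power_divide)
      then show ?thesis
        using unit_ball_vol_sqrt_DIM[where 'a = 'a] by (intro exI[of _ "sqrt ?n / 2"]) simp
    qed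
  qed
  then obtain r where "r > 0" "?\<kappa> * r ^ ?n \<ge> 1"
    and "\<And>K :: 'a set. convex_body K \<Longrightarrow> measure lborel (nbhd r K) \<le> fact ?n * wills K"
    by blast
  then show thesis
    using that[of r] wills_le_measure_nbhd[where 'a = 'a and r = r]
    by (auto simp: convex_body_def compact_imp_bounded)
qed

lemma bounded_psum_pscale:
  assumes "bounded K" "bounded L" "p > 1"
  shows "bounded (psum p (pscale p s K) (pscale p t L) :: 'a::real_normed_vector set)"
proof -
  obtain R S where RS: "\<And>x. x \<in> K \<Longrightarrow> norm x \<le> R" "\<And>y. y \<in> L \<Longrightarrow> norm y \<le> S"
    using assms by (auto simp: bounded_iff)
  have q: "1 / hconj p \<ge> 0"
    using assms(3) by (simp add: hconj_def)
  show ?thesis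
    unfolding bounded_iff
  proof (intro exI ballI)
    fix z assume "z \<in> psum p (pscale p s K) (pscale p t L)"
    then obtain x y \<mu> where z: "z = (1 - \<mu>) powr (1 / hconj p) *\<^sub>R s powr (1 / p) *\<^sub>R x
        + \<mu> powr (1 / hconj p) *\<^sub>R t powr (1 / p) *\<^sub>R y" and xy: "x \<in> K" "y \<in> L" "\<mu> \<in> {0..1}"
      by (auto simp: psum_def pscale_def)
    have "norm z \<le> (1 - \<mu>) powr (1 / hconj p) * (s powr (1 / p) * norm x)
        + \<mu> powr (1 / hconj p) * (t powr (1 / p) * norm y)"
      unfolding z by (rule order_trans[OF norm_triangle_ineq]) simp
    also have "\<dots> \<le> 1 * (s powr (1 / p) * R) + 1 * (t powr (1 / p) * S)"
      using xy RS q by (intro add_mono mult_mono powr_le1) auto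
    finally show "norm z \<le> s powr (1 / p) * R + t powr (1 / p) * S"
      by simp
  qed
qed

text \<open>The parameter maximising \<open>a * x + b * y\<close> is the equality case of Hoelder's inequality, while
  \<open>a + b \<le> 1\<close> holds for every parameter by Young's inequality.\<close>

lemma psum_coefficients:
  fixes p t x y :: real
  assumes "p > 1" "0 < t" "t < 1" "x > 0" "y > 0"
  obtains \<mu> a b where "\<mu> \<in> {0..1}"
    "a = (1 - \<mu>) powr (1 / hconj p) * (1 - t) powr (1 / p)"
    "b = \<mu> powr (1 / hconj p) * t powr (1 / p)"
    "a > 0" "b > 0" "a + b \<le> 1" "(a * x + b * y) powr p = (1 - t) * x powr p + t * y powr p"
proof -
  define S where "S = (1 - t) * x powr p + t * y powr p"
  have S: "S > 0"
    using assms by (auto simp: S_def intro!: add_pos_pos mult_pos_pos)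
  define \<mu> where "\<mu> = t * y powr p / S"
  have \<mu>1: "1 - \<mu> = (1 - t) * x powr p / S"
    using S by (simp add: \<mu>_def S_def field_simps)
  have \<mu>: "0 < \<mu>" "0 < 1 - \<mu>"
    unfolding \<mu>1 using S assms by (auto simp: \<mu>_def)
  have q: "1 / hconj p = 1 - 1 / p"
    using assms by (simp add: hconj_def field_simps)
  define a b where "a = (1 - \<mu>) powr (1 / hconj p) * (1 - t) powr (1 / p)"
    and "b = \<mu> powr (1 / hconj p) * t powr (1 / p)"
  have ab: "a > 0" "b > 0"
    using \<mu> assms by (auto simp: a_def b_def)
  \<comment> \<open>Young's inequality with weights \<open>1 - 1 / p\<close> and
    \<open>1 / p\<close>; in the sum each weight is multiplied by 1.\<close>
  have "a \<le> (1 - 1 / p) * (1 - \<mu>) + 1 / p * (1 - t)" "b \<le> (1 - 1 / p) * \<mu> + 1 / p * t"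
    unfolding a_def b_def q using \<mu> assms Youngs_inequality_0[of "1 - 1 / p" "1 / p" "1 - \<mu>" "1 - t"]
      Youngs_inequality_0[of "1 - 1 / p" "1 / p" \<mu> t] by simp_all
  then have "a + b \<le> ((1 - 1 / p) * (1 - \<mu>) + 1 / p * (1 - t)) + ((1 - 1 / p) * \<mu> + 1 / p * t)"
    by (rule add_mono)
  also have "\<dots> = 1"
    using assms by (simp add: field_simps)
  finally have "a + b \<le> 1" .
  \<comment> \<open>Both summands of \<open>a * x + b * y\<close> carry the same power of
    \<open>S\<close>, so their sum is \<open>S * S powr (1 / p - 1)\<close>.\<close>
  have coef: "(w * z powr p / S) powr (1 / hconj p) * w powr (1 / p) * z = w * z powr p * S powr (1 / p - 1)"
    if "w > 0" "z > 0" for w z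
  proof -
    have "(w * z powr p / S) powr (1 / hconj p)
        = w powr (1 - 1 / p) * z powr (p * (1 - 1 / p)) * S powr (1 / p - 1)"
      unfolding q using that S powr_minus_divide[of S "1 - 1 / p"]
      by (simp add: powr_divide powr_mult powr_powr)
    moreover have "z powr (p * (1 - 1 / p)) * z = z powr p"
    proof -
      have "z powr (p * (1 - 1 / p)) * z = z powr (p * (1 - 1 / p)) * z powr 1"
        using that by simp
      also have "\<dots> = z powr (p * (1 - 1 / p) + 1)"
        by (simp only: powr_add)
      also have "p * (1 - 1 / p) + 1 = p"
        using assms by (simp add: field_simps)
      finally show ?thesis .
    qed
    moreover have "w powr (1 - 1 / p) * w powr (1 / p) = w"
      using that by (simp flip: powr_add)
    ultimately show ?thesis
      by (metis (no_types, opaque_lifting) mult.assoc mult.commute)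
  qed
  have "a * x + b * y = S * S powr (1 / p - 1)"
    unfolding a_def b_def \<mu>1 using coef[of "1 - t" x] coef[of t y] assms
    by (simp add: \<mu>_def S_def algebra_simps)
  also have "\<dots> = S powr 1 * S powr (1 / p - 1)"
    using S by simp
  also have "\<dots> = S powr (1 / p)"
    unfolding powr_add[symmetric] by simp
  finally have "(a * x + b * y) powr p = S"
    using assms S by (simp add: powr_powr)
  then show thesis
    using that[of \<mu> a b] \<mu> ab \<open>a + b \<le> 1\<close> by (simp add: a_def b_def S_def)
qed

theorem theorem1p2:
  fixes K L :: "'a::euclidean_space set" and p t :: real
  assumes "convex_body K" and "convex_body L" and "p > 1"
    and "0 < t" and "t < 1"
  shows "wills (psum p (pscale p (1 - t) K) (pscale p t L)) powr (p / DIM('a))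
    \<ge> (1 / (fact DIM('a)) powr (p / DIM('a)))
       * ((1 - t) * wills K powr (p / DIM('a)) + t * wills L powr (p / DIM('a)))"
proof -
  let ?n = "DIM('a)" and ?M = "psum p (pscale p (1 - t) K) (pscale p t L)"
  obtain r where r: "r > 0"
    and le: "\<And>K :: 'a set. convex_body K \<Longrightarrow> wills K \<le> measure lborel (nbhd r K)"
    and ge: "\<And>K :: 'a set. convex_body K \<Longrightarrow> measure lborel (nbhd r K) \<le> fact ?n * wills K"
    using wills_equivalent_measure_nbhd by blast
  define x where "x C = root ?n (measure lborel (nbhd r C))" for C :: "'a set"
  have body: "C \<noteq> {}" "bounded C" if "convex_body C" for C :: "'a set"
    using that by (auto simp: convex_body_def compact_imp_bounded)
  have x: "x C > 0" "x C powr p = measure lborel (nbhd r C) powr (p / ?n)" if "convex_body C" for C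
    using measure_nbhd_pos[OF body[OF that] r] by (simp_all add: x_def root_powr_inverse powr_powr)
  obtain \<mu> a b where \<mu>: "\<mu> \<in> {0..1}"
    "a = (1 - \<mu>) powr (1 / hconj p) * (1 - t) powr (1 / p)"
    "b = \<mu> powr (1 / hconj p) * t powr (1 / p)"
    and ab: "a > 0" "b > 0" "a + b \<le> 1"
    and S: "(a * x K + b * x L) powr p = (1 - t) * x K powr p + t * x L powr p"
    using psum_coefficients[OF assms(3-5) x(1)[OF assms(1)] x(1)[OF assms(2)]] by metis
  let ?N = "(*\<^sub>R) a ` K + (*\<^sub>R) b ` L"
  have N: "convex_body ?N"
  proof -
    have "?N = (\<Union>x\<in>(*\<^sub>R) a ` K. \<Union>y\<in>(*\<^sub>R) b ` L. {x + y})"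
      by (auto simp: set_plus_def)
    then have "compact ?N"
      using assms(1,2) compact_sums'[of "(*\<^sub>R) a ` K" "(*\<^sub>R) b ` L"]
      by (simp add: convex_body_def compact_scaling)
    moreover have "convex ?N"
      using assms(1,2) by (simp add: convex_body_def convex_set_plus convex_scaling)
    moreover have "?N \<noteq> {}"
      using body(1)[OF assms(1)] body(1)[OF assms(2)] by (auto simp: set_plus_def)
    ultimately show ?thesis
      by (simp add: convex_body_def)
  qed
  \<comment> \<open>\<open>?N\<close> is the part of the p-sum belonging to the single parameter
    \<mu>.\<close>
  have "?N \<subseteq> ?M"
  proof
    fix z assume "z \<in> ?N"
    then obtain k l where kl: "k \<in> K" "l \<in> L" "z = a *\<^sub>R k + b *\<^sub>R l"
      by (auto simp: set_plus_def)
    then have "z = (1 - \<mu>) powr (1 / hconj p) *\<^sub>R ((1 - t) powr (1 / p) *\<^sub>R k)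
        + \<mu> powr (1 / hconj p) *\<^sub>R (t powr (1 / p) *\<^sub>R l)"
      by (simp add: \<mu>)
    then show "z \<in> ?M"
      unfolding psum_def pscale_def using kl(1,2) \<mu>(1) by blast
  qed
  \<comment> \<open>The comparison with \<open>V\<close> is made for the convex body
    \<open>?N\<close>; monotonicity carries the result over to the p-sum, whose boundedness ensures
    integrability.\<close>
  then have NM: "wills ?N \<le> wills ?M"
    using body[OF N] body[OF assms(1)] body[OF assms(2)] assms(3)
    by (intro wills_mono bounded_psum_pscale)
  have "a * x K + b * x L \<le> root ?n (measure lborel (nbhd (a * r + b * r) ?N))"
    unfolding x_def using body[OF assms(1)] body[OF assms(2)] ab r
    by (intro root_measure_nbhd_concave)
  \<comment> \<open>Here \<open>a + b \<le> 1\<close> enters: the radius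
    \<open>a * r + b * r\<close> is at most \<open>r\<close>.\<close>
  also have "\<dots> \<le> x ?N"
    unfolding x_def using body[OF N] ab r mult_right_mono[of "a + b" 1 r]
    by (intro real_root_le_mono measure_nbhd_mono) (auto simp: distrib_right)
  finally have "(a * x K + b * x L) powr p \<le> x ?N powr p"
    using ab x(1)[OF assms(1)] x(1)[OF assms(2)] assms(3) by (intro powr_mono2) auto
  also have "\<dots> \<le> (fact ?n * wills ?M) powr (p / ?n)"
    unfolding x(2)[OF N] using assms(3) ge[OF N] NM
    by (intro powr_mono2) (auto intro: order_trans[OF _ mult_left_mono])
  also have "\<dots> = fact ?n powr (p / ?n) * wills ?M powr (p / ?n)"
    using wills_nonneg by (intro powr_mult) 
  finally have upper: "(1 - t) * x K powr p + t * x L powr p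
      \<le> fact ?n powr (p / ?n) * wills ?M powr (p / ?n)"
    unfolding S .
  have "wills C powr (p / ?n) \<le> x C powr p" if "convex_body C" for C
    unfolding x(2)[OF that] using assms(3) le[OF that] by (intro powr_mono2) (auto simp: wills_nonneg)
  then have "(1 - t) * wills K powr (p / ?n) + t * wills L powr (p / ?n)
      \<le> (1 - t) * x K powr p + t * x L powr p"
    using assms by (intro add_mono mult_left_mono) auto
  with upper show ?thesis
    by (simp add: field_simps)
qed

end
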